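(* Fix $\lambda\in[0,1)$ and $p\in[0,1]$. For every $N$, the process $\mathbf{V}^N(t)$ of the $N$-station system is positive recurrent and admits a unique steady-state distribution $\pi^N$ on $\overline{\mathcal{V}}^\infty$. Moreover, $\pi^N$ converges in distribution, as $N\to\infty$, to $\delta_{\mathbf{v}^I}$, the probability measure on $\overline{\mathcal{V}}^\infty$ (with the $\|\cdot\|_w$ topology) concentrated on the point $\mathbf{v}^I$, where $\mathbf{v}^I$ is the unique element of $\overline{\mathcal{V}}^\infty$ satisfying $\lambda(\mathbf{v}^I_{i-1}-\mathbf{v}^I_i)-(1-p)(\mathbf{v}^I_i-\mathbf{v}^I_{i+1})-g_i(\mathbf{v}^I)=0$ for all $i\ge1$.
   Context: The $N$-station system: station $n\in\{1,\dots,N\}$ has queue length $Q_n(t)\in\mathbb{Z}_+$, initially finite. Tasks arrive to each station according to independent Poisson processes of rate $\lambda$. Each station has an independent Poisson clock of rate $1-p$: at a tick, if $Q_n>0$ one task leaves station $n$, otherwise nothing happens. An independent central Poisson clock of rate $Np$: at a tick, if $\sum_nQ_n>0$ one task leaves a station chosen uniformly at random among stations with a longest queue, otherwise nothing happens. $\mathbf{S}^N_i(t)=\frac1N\sum_n\mathbb{I}\{Q_n(t)\ge i\}$, $\mathbf{V}^N_i(t)=\sum_{j\ge i}\mathbf{S}^N_j(t)$, $i\ge0$. $\mathcal{S}=\{\mathbf{s}\in[0,1]^{\mathbb{Z}_+}:1=\mathbf{s}_0\ge\mathbf{s}_1\ge\cdots\ge0\}$, $\overline{\mathcal{S}}^\infty=\{\mathbf{s}\in\mathcal{S}:\sum_{i\ge1}\mathbf{s}_i<\infty\}$,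 $\overline{\mathcal{V}}^\infty=\{\mathbf{v}:\mathbf{v}_i=\sum_{j\ge i}\mathbf{s}_j\ \forall i,\text{ for some }\mathbf{s}\in\overline{\mathcal{S}}^\infty\}$, $\|\mathbf{x}\|_w^2=\sum_{i\ge0}2^{-i}\mathbf{x}_i^2$. For $i\ge1$: $g_i(\mathbf{v})=p$ if $\mathbf{v}_i>0$, $=\min\{\lambda\mathbf{v}_{i-1},p\}$ if $\mathbf{v}_i=0<\mathbf{v}_{i-1}$, $=0$ if $\mathbf{v}_i=\mathbf{v}_{i-1}=0$. (Such $\mathbf{v}^I$ exists and is unique.) *)

theory Defs
  imports "HOL-Probability.Probability"
begin

text \<open>A CTMC is given by its off-diagonal rate function q (q x y = rate of jumping x to y, q x x = 0).\<close>

definition exit_rate :: "('a \<Rightarrow> 'a \<Rightarrow> real) \<Rightarrow> 'a \<Rightarrow> real" where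
  "exit_rate q x = (\<Sum>\<^sub>\<infinity>y\<in>-{x}. q x y)"

text \<open>Uniformized jump matrix with uniformization constant Lam (Lam bounds all exit rates).\<close>
definition unif :: "real \<Rightarrow> ('a \<Rightarrow> 'a \<Rightarrow> real) \<Rightarrow> 'a \<Rightarrow> 'a \<Rightarrow> real" where
  "unif Lam q x y = (if y = x then 1 - exit_rate q x / Lam else q x y / Lam)"

fun fpt :: "('a \<Rightarrow> 'a \<Rightarrow> real) \<Rightarrow> nat \<Rightarrow> 'a \<Rightarrow> 'a \<Rightarrow> real" where
  "fpt P 0 x y = 0"
| "fpt P (Suc 0) x y = P x y"
| "fpt P (Suc (Suc n)) x y = (\<Sum>\<^sub>\<infinity>z\<in>-{y}. P x z * fpt P (Suc n) z y)"

definition hit_prob :: "('a \<Rightarrow> 'a \<Rightarrow> real) \<Rightarrow> 'a \<Rightarrow> 'a \<Rightarrow> real" where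
  "hit_prob P x y = (\<Sum>n. fpt P n x y)"

definition pos_rec_state :: "('a \<Rightarrow> 'a \<Rightarrow> real) \<Rightarrow> 'a \<Rightarrow> bool" where
  "pos_rec_state P x \<longleftrightarrow> hit_prob P x x = 1 \<and> summable (\<lambda>n. real n * fpt P n x x)"

definition ctmc_pos_recurrent :: "real \<Rightarrow> ('a \<Rightarrow> 'a \<Rightarrow> real) \<Rightarrow> 'a set \<Rightarrow> bool" where
  "ctmc_pos_recurrent Lam q X \<longleftrightarrow>
     (\<exists>x0\<in>X. pos_rec_state (unif Lam q) x0 \<and> (\<forall>x\<in>X. hit_prob (unif Lam q) x x0 = 1))"

definition ctmc_stationary :: "('a \<Rightarrow> 'a \<Rightarrow> real) \<Rightarrow> 'a set \<Rightarrow> 'a pmf \<Rightarrow> bool" where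
  "ctmc_stationary q X \<pi> \<longleftrightarrow> set_pmf \<pi> \<subseteq> X \<and>
     (\<forall>y\<in>X. (\<Sum>\<^sub>\<infinity>x\<in>X. pmf \<pi> x * q x y) = pmf \<pi> y * exit_rate q y)"

definition Sbar :: "(nat \<Rightarrow> real) set" where
  "Sbar = {s. s 0 = 1 \<and> (\<forall>i. 0 \<le> s i \<and> s i \<le> 1 \<and> s (Suc i) \<le> s i) \<and>
              summable (\<lambda>i. s (Suc i))}"

definition Vbar :: "(nat \<Rightarrow> real) set" where
  "Vbar = {v. \<exists>s\<in>Sbar. \<forall>i. v i = (\<Sum>j. s (i + j))}"

definition wnorm :: "(nat \<Rightarrow> real) \<Rightarrow> real" where
  "wnorm x = sqrt (\<Sum>i. (1/2)^i * (x i)^2)"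

definition g_fun :: "real \<Rightarrow> real \<Rightarrow> (nat \<Rightarrow> real) \<Rightarrow> nat \<Rightarrow> real" where
  "g_fun lam p v i =
     (if v i > 0 then p
      else if v (i - 1) > 0 then min (lam * v (i - 1)) p
      else 0)"

definition vI_eqs :: "real \<Rightarrow> real \<Rightarrow> (nat \<Rightarrow> real) \<Rightarrow> bool" where
  "vI_eqs lam p v \<longleftrightarrow> (\<forall>i\<ge>1.
     lam * (v (i - 1) - v i) - (1 - p) * (v i - v (i + 1)) - g_fun lam p v i = 0)"

text \<open>S^N and V^N of a queue-length configuration Q (stations 0..N-1).\<close>
definition S_of :: "nat \<Rightarrow> (nat \<Rightarrow> nat) \<Rightarrow> nat \<Rightarrow> real" where
  "S_of N Q i = real (card {n. n < N \<and> Q n \<ge> i}) / real N"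

definition V_of :: "nat \<Rightarrow> (nat \<Rightarrow> nat) \<Rightarrow> nat \<Rightarrow> real" where
  "V_of N Q i = (\<Sum>j. S_of N Q (i + j))"

definition XV :: "nat \<Rightarrow> (nat \<Rightarrow> real) set" where
  "XV N = {V_of N Q | Q. True}"

definition s_of_v :: "(nat \<Rightarrow> real) \<Rightarrow> nat \<Rightarrow> real" where
  "s_of_v v i = v i - v (Suc i)"

text \<open>S_i increases / decreases by 1/N (one station moves from level i-1 to i / from i to i-1).\<close>
definition vup :: "nat \<Rightarrow> nat \<Rightarrow> (nat \<Rightarrow> real) \<Rightarrow> nat \<Rightarrow> real" where
  "vup N i v = (\<lambda>j. if j \<le> i then v j + 1 / real N else v j)"

definition vdown :: "nat \<Rightarrow> nat \<Rightarrow> (nat \<Rightarrow> real) \<Rightarrow> nat \<Rightarrow> real" where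
  "vdown N i v = (\<lambda>j. if j \<le> i then v j - 1 / real N else v j)"

text \<open>Transition rates of V^N:
  arrivals: rate lam per station, i.e. lam N (s_{i-1}-s_i) for a station at level i-1 going to i;
  local departures: rate (1-p) per nonempty station, (1-p) N (s_i - s_{i+1}) from level i;
  central departures: rate N p from a longest queue (level L = max{i. s_i>0}) if the system is nonempty.\<close>
definition qV :: "real \<Rightarrow> real \<Rightarrow> nat \<Rightarrow> (nat \<Rightarrow> real) \<Rightarrow> (nat \<Rightarrow> real) \<Rightarrow> real" where
  "qV lam p N v w =
    (if w = v then 0 else
      (\<Sum>i\<in>{i. 1 \<le> i \<and> vup N i v = w}. lam * real N * (s_of_v v (i - 1) - s_of_v v i))
    + (\<Sum>i\<in>{i. 1 \<le> i \<and> vdown N i v = w}. (1 - p) * real N * (s_of_v v i - s_of_v v (Suc i)))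
    + (if v 1 > 0 \<and> vdown N (GREATEST i. s_of_v v i > 0) v = w then real N * p else 0))"

text \<open>Uniformization constant, bounding the total jump rate N lam + N (1-p) + N p.\<close>
definition LamN :: "real \<Rightarrow> nat \<Rightarrow> real" where
  "LamN lam N = real N * (lam + 1) + 1"

end

theory Submission
  imports Defs
begin

text \<open>Positive recurrence follows from Foster's criterion. The stationary law is the normalized
  occupation measure of an excursion from the empty state, and it is unique since the taboo iterates vanish.

  For the limit no fluid trajectory is needed. Let \<open>d j = v j - a j\<close>, where \<open>a\<close> is an equilibrium, and
  let \<open>\<phi> x = sqrt (\<delta>\<^sup>2 + x\<^sup>2)\<close>, a smooth convex version of \<open>\<bar>x\<bar>\<close>. The central service is monotone in
  \<open>v j\<close> and can be dropped, so convexity bounds the generator at \<open>\<phi> (d j)\<close> by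
  \<open>lam (\<phi> (d (j-1)) - \<phi> (d j)) + (1-p) (\<phi> (d (j+1)) - \<phi> (d j)) + 1 / (\<delta> N)\<close>. Its stationary mean is zero, and
  \<open>d 0 = d 1\<close>. Hence, for \<open>p < 1\<close>, the means \<open>x j\<close> of \<open>\<phi> (d j)\<close> satisfy \<open>x j - x (j+1) = O(1 / (\<delta> N))\<close>
  inductively, and \<open>x j\<close> is bounded by the tail mean \<open>x k\<close>, which is small for large \<open>k\<close> since
  the stationary mean of \<open>v k\<close> is at most \<open>lam^k / (1 - lam)\<close>. For \<open>p = 1\<close> the total queue length
  has negative drift and the equilibrium is the empty state.\<close>

section \<open>Taboo iterates, recurrence and stationary laws of a Markov kernel\<close>

text \<open>Stationarity replaces trajectories by the equation "mean of \<open>gen q F\<close> is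
  0", but \<open>F\<close> must be integrable first. Queue lengths are unbounded, so moments are
  obtained from truncations \<open>min (v j) M\<close>, and only then are smoothed distances
  admissible.

  The smoothing is needed for the kink of \<bar>x\<bar>: jumps have size 1 / N and total rate of
  order N, so at the kink the absolute value would leave an error of order one, whereas a second
  derivative of at most 1 / \<delta> leaves 1 / (\<delta> N). The level k and \<delta> are therefore
  fixed before N grows.

  The discontinuity of the central service does no harm: at \<open>v i = 0\<close> the value of
  \<open>g_fun\<close> lies between 0 and \<open>p\<close>, filling the jump of \<open>p\<close>
  times the indicator of an occupied level. The difference of the two services multiplied by
  \<open>d j\<close> is thus never negative.

  The identity \<open>d 0 = d 1\<close> acts as a reflecting boundary. Each later step of the
  induction divides by \<open>1 - p\<close>, so \<open>p = 1\<close> needs its own argument: there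
  \<open>v 1\<close> is a birth-death walk, and the drift of its square bounds its mean by order 1 /
  N.\<close>

lemma pmf_eqI_except:
  assumes "\<And>y. y \<noteq> e \<Longrightarrow> pmf p y = pmf q y"
  shows "p = q"
proof (rule pmf_eqI)
  fix y
  have mass: "pmf r e = 1 - infsetsum (pmf r) (- {e})" for r :: "'a pmf"
    using measure_pmf.prob_compl[of "{e}" r]
    by (simp add: measure_pmf_conv_infsetsum[symmetric] measure_pmf_single Compl_eq_Diff_UNIV)
  have "infsetsum (pmf p) (- {e}) = infsetsum (pmf q) (- {e})"
    using assms by (intro infsetsum_cong) auto
  then show "pmf p y = pmf q y"
    using assms mass by (cases "y = e") simp_all
qed

text \<open>The value at \<open>e\<close> is erased after the step, not before it. The n-fold
  iterate is thus the mean of \<open>f\<close> at time n over the event of no visit to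
  \<open>e\<close> at times 1 to n, and a start in \<open>e\<close> itself is permitted.\<close>

definition taboo :: "('a \<Rightarrow> 'a pmf) \<Rightarrow> 'a \<Rightarrow> ('a \<Rightarrow> real) \<Rightarrow> 'a \<Rightarrow> real" where
  "taboo K e f x = measure_pmf.expectation (K x) (\<lambda>z. if z = e then 0 else f z)"

locale finite_kernel =
  fixes K :: "'a \<Rightarrow> 'a pmf" and X :: "'a set" and e :: 'a
  assumes finite_supp: "finite (set_pmf (K x))"
    and closed: "x \<in> X \<Longrightarrow> set_pmf (K x) \<subseteq> X"
    and e_in: "e \<in> X"
begin

abbreviation T where "T \<equiv> taboo K e"

text \<open>Tail of the hitting or return time: the probability of no visit to \<open>e\<close> at
  times 1 to \<open>n\<close>.\<close>

definition surv :: "nat \<Rightarrow> 'a \<Rightarrow> real" where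
  "surv n = (T ^^ n) (\<lambda>_. 1)"

lemma integrable_K [simp, intro]: "integrable (measure_pmf (K x)) (f :: 'a \<Rightarrow> real)"
  using finite_supp by (rule integrable_measure_pmf_finite)

lemma expectation_K: "measure_pmf.expectation (K x) f = (\<Sum>z\<in>set_pmf (K x). pmf (K x) z * f z)"
  for f :: "'a \<Rightarrow> real"
  using finite_supp by (subst integral_measure_pmf[of "set_pmf (K x)"]) auto

lemma expectation_K_mono:
  fixes f g :: "'a \<Rightarrow> real"
  assumes "\<And>z. z \<in> set_pmf (K x) \<Longrightarrow> f z \<le> g z"
  shows "measure_pmf.expectation (K x) f \<le> measure_pmf.expectation (K x) g"
  unfolding expectation_K by (intro sum_mono mult_left_mono assms) auto

lemma surv_0 [simp]: "surv 0 x = 1"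
  and surv_Suc: "surv (Suc n) x = T (surv n) x"
  by (simp_all add: surv_def)

lemma taboo_range:
  assumes "\<And>z. 0 \<le> f z \<and> f z \<le> 1"
  shows "0 \<le> T f x \<and> T f x \<le> 1"
proof
  show "0 \<le> T f x"
    unfolding taboo_def using assms by (intro Bochner_Integration.integral_nonneg) auto
  have "T f x \<le> measure_pmf.expectation (K x) (\<lambda>_. 1)"
    unfolding taboo_def using assms by (intro expectation_K_mono) auto
  then show "T f x \<le> 1" by simp
qed

lemma taboo_iter_range:
  assumes "\<And>z. 0 \<le> f z \<and> f z \<le> 1"
  shows "0 \<le> (T ^^ n) f x \<and> (T ^^ n) f x \<le> 1"
  using assms by (induction n arbitrary: x) (simp_all add: taboo_range)

lemma surv_range: "0 \<le> surv n x" "surv n x \<le> 1"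
  using taboo_iter_range[of "\<lambda>_. 1" n x] by (simp_all add: surv_def)

lemma taboo_mono:
  assumes "\<And>z. f z \<le> g z"
  shows "T f x \<le> T g x"
  unfolding taboo_def using assms by (intro expectation_K_mono) auto

lemma taboo_iter_mono:
  assumes "\<And>z. f z \<le> g z"
  shows "(T ^^ n) f x \<le> (T ^^ n) g x"
  using assms by (induction n arbitrary: x) (simp_all add: taboo_mono)

lemma taboo_iter_le_surv:
  assumes "\<And>z. 0 \<le> f z \<and> f z \<le> 1"
  shows "(T ^^ n) f x \<le> surv n x"
  unfolding surv_def using assms by (intro taboo_iter_mono) auto

lemma surv_decseq: "surv (Suc n) x \<le> surv n x"
proof -
  have "(T ^^ n) (T (\<lambda>_. 1)) x \<le> surv n x"
    using taboo_range[of "\<lambda>_. 1"] by (intro taboo_iter_le_surv) auto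
  then show ?thesis
    unfolding surv_def by (simp add: funpow_swap1)
qed

text \<open>A first visit at time n + 1 means surviving n steps but not n + 1. The sums over
  \<open>fpt\<close> that define recurrence thereby telescope. Agreement with the kernel is asked on
  \<open>X\<close> only, because \<open>unif\<close> need not be stochastic elsewhere.\<close>

lemma fpt_eq_surv:
  assumes P: "\<And>x y. x \<in> X \<Longrightarrow> P x y = pmf (K x) y" and "x \<in> X"
  shows "fpt P (Suc n) x e = surv n x - surv (Suc n) x"
  using \<open>x \<in> X\<close>
proof (induction n arbitrary: x)
  case 0
  have "T (surv 0) x = measure_pmf.expectation (K x) (\<lambda>z. 1 - indicator {e} z)"
    unfolding taboo_def by (intro Bochner_Integration.integral_cong) (auto simp: indicator_def)
  also have "\<dots> = 1 - pmf (K x) e"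
    by (subst Bochner_Integration.integral_diff) (auto simp: pmf.rep_eq)
  finally show ?case
    using 0 by (simp add: surv_Suc P)
next
  case (Suc n)
  have "fpt P (Suc (Suc n)) x e
      = (\<Sum>\<^sub>\<infinity>z\<in>set_pmf (K x). pmf (K x) z * (if z = e then 0 else fpt P (Suc n) z e))"
    unfolding fpt.simps
    by (rule infsum_cong_neutral) (auto simp: P[OF Suc.prems] set_pmf_iff)
  also have "\<dots> = (\<Sum>z\<in>set_pmf (K x). pmf (K x) z *
      ((if z = e then 0 else surv n z) - (if z = e then 0 else surv (Suc n) z)))"
    using finite_supp closed[OF Suc.prems] Suc.IH by (auto intro!: sum.cong)
  also have "\<dots> = T (surv n) x - T (surv (Suc n)) x"
    by (simp add: taboo_def expectation_K right_diff_distrib sum_subtractf)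
  finally show ?case
    by (simp add: surv_Suc)
qed

text \<open>Tonelli for nonnegative functions yields integrability of the one-step mean along with
  the identity, so unbounded \<open>f\<close> are covered. Signs are known only on \<open>X\<close>,
  which carries \<open>\<pi>\<close>; hence the almost-everywhere arguments.\<close>

lemma stationary_expectation:
  fixes f :: "'a \<Rightarrow> real"
  assumes stat: "bind_pmf \<pi> K = \<pi>" and supp: "set_pmf \<pi> \<subseteq> X"
    and nonneg: "\<And>x. x \<in> X \<Longrightarrow> 0 \<le> f x" and int: "integrable (measure_pmf \<pi>) f"
  shows "integrable (measure_pmf \<pi>) (\<lambda>x. measure_pmf.expectation (K x) f)"
    and "measure_pmf.expectation \<pi> (\<lambda>x. measure_pmf.expectation (K x) f) = measure_pmf.expectation \<pi> f"
proof -
  let ?Kf = "\<lambda>x. measure_pmf.expectation (K x) f"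
  have K_nonneg: "AE y in K x. 0 \<le> f y" if "x \<in> X" for x
    using closed[OF that] nonneg by (auto simp: AE_measure_pmf_iff)
  have Kf_nonneg: "0 \<le> ?Kf x" if "x \<in> X" for x
    using K_nonneg[OF that] by (rule integral_nonneg_AE)
  have AE_f: "AE x in \<pi>. 0 \<le> f x" and AE_Kf: "AE x in \<pi>. 0 \<le> ?Kf x"
    using supp nonneg Kf_nonneg by (auto simp: AE_measure_pmf_iff)
  have "(\<integral>\<^sup>+x. ennreal (f x) \<partial>\<pi>) = (\<integral>\<^sup>+x. \<integral>\<^sup>+y. ennreal (f y) \<partial>K x \<partial>\<pi>)"
    by (subst stat[symmetric]) (rule nn_integral_bind_pmf)
  also have "\<dots> = (\<integral>\<^sup>+x. ennreal (?Kf x) \<partial>\<pi>)"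
    using supp
    by (intro nn_integral_cong_AE)
      (auto simp: AE_measure_pmf_iff intro!: nn_integral_eq_integral K_nonneg[unfolded AE_measure_pmf_iff])
  finally have eq: "(\<integral>\<^sup>+x. ennreal (?Kf x) \<partial>\<pi>) = (\<integral>\<^sup>+x. ennreal (f x) \<partial>\<pi>)" ..
  also have "\<dots> < \<infinity>"
    using int AE_f by (simp add: nn_integral_eq_integral)
  finally show int': "integrable (measure_pmf \<pi>) ?Kf"
    using AE_Kf by (intro integrableI_nonneg) auto
  show "measure_pmf.expectation \<pi> ?Kf = measure_pmf.expectation \<pi> f"
    using eq AE_f AE_Kf by (simp add: integral_eq_nn_integral)
qed

text \<open>The previous state is either \<open>e\<close>, whose mass starts a new excursion, or
  not, and then the mass is moved by the taboo operator.\<close>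

lemma stationary_taboo:
  fixes f :: "'a \<Rightarrow> real"
  assumes stat: "bind_pmf \<pi> K = \<pi>" and supp: "set_pmf \<pi> \<subseteq> X"
    and f: "\<And>z. 0 \<le> f z \<and> f z \<le> 1"
  shows "measure_pmf.expectation \<pi> (\<lambda>z. if z = e then 0 else f z)
    = pmf \<pi> e * T f e + measure_pmf.expectation \<pi> (\<lambda>z. if z = e then 0 else T f z)"
proof -
  have int: "integrable (measure_pmf \<pi>) g" if "\<And>z. 0 \<le> g z \<and> g z \<le> 1" for g :: "'a \<Rightarrow> real"
    using that by (intro measure_pmf.integrable_const_bound[where B=1]) auto
  have "measure_pmf.expectation \<pi> (\<lambda>z. if z = e then 0 else f z) = measure_pmf.expectation \<pi> (T f)"
    unfolding taboo_def using f
    by (intro stationary_expectation(2)[OF stat supp, symmetric] int) auto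
  also have "\<dots> = measure_pmf.expectation \<pi>
      (\<lambda>z. indicator {e} z * T f e + (if z = e then 0 else T f z))"
    by (intro Bochner_Integration.integral_cong) (auto simp: indicator_def)
  also have "\<dots> = pmf \<pi> e * T f e + measure_pmf.expectation \<pi> (\<lambda>z. if z = e then 0 else T f z)"
    using taboo_range[of f, OF f]
    by (subst Bochner_Integration.integral_add)
      (auto intro!: int simp: measure_pmf_single split: split_indicator)
  finally show ?thesis .
qed

end

section \<open>Foster's criterion: recurrence with finite mean return time\<close>

locale foster_kernel = finite_kernel +
  fixes h :: "'a \<Rightarrow> real" and \<epsilon> :: real
  assumes h_nonneg: "x \<in> X \<Longrightarrow> 0 \<le> h x"
    and eps_pos: "0 < \<epsilon>"
    and drift: "x \<in> X \<Longrightarrow> x \<noteq> e \<Longrightarrow> measure_pmf.expectation (K x) h \<le> h x - \<epsilon>"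
begin

lemma sum_surv_Suc:
  "(\<Sum>n<Suc M. surv n x) = 1 + T (\<lambda>z. \<Sum>n<M. surv n z) x"
proof -
  have "T (\<lambda>z. \<Sum>n<M. surv n z) x
      = measure_pmf.expectation (K x) (\<lambda>z. \<Sum>n<M. if z = e then 0 else surv n z)"
    unfolding taboo_def by (intro Bochner_Integration.integral_cong) auto
  also have "\<dots> = (\<Sum>n<M. T (surv n) x)"
    unfolding taboo_def by (intro Bochner_Integration.integral_sum) auto
  finally have "(\<Sum>n<M. T (surv n) x) = T (\<lambda>z. \<Sum>n<M. surv n z) x" ..
  then show ?thesis
    by (subst sum.lessThan_Suc_shift) (simp add: surv_Suc)
qed

text \<open>The sum is the mean of the return time cut off at \<open>M\<close>. Each step outside
  \<open>e\<close> costs at least \<open>\<epsilon>\<close> of \<open>h\<close>, so a start outside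
  \<open>e\<close> can afford \<open>h x / \<epsilon>\<close> steps. The second bound spends one
  step first and so also covers \<open>x = e\<close>, where no drift is assumed.\<close>

lemma sum_surv_le:
  assumes "x \<in> X"
  shows "x \<noteq> e \<Longrightarrow> (\<Sum>n<M. surv n x) \<le> h x / \<epsilon>"
    and "(\<Sum>n<M. surv n x) \<le> 1 + measure_pmf.expectation (K x) h / \<epsilon>"
proof -
  have step: "(\<Sum>n<Suc M. surv n x) \<le> 1 + measure_pmf.expectation (K x) h / \<epsilon>"
    if "x \<in> X" and "\<And>z. z \<in> X \<Longrightarrow> z \<noteq> e \<Longrightarrow> (\<Sum>n<M. surv n z) \<le> h z / \<epsilon>" for M x
  proof -
    have "T (\<lambda>z. \<Sum>n<M. surv n z) x \<le> measure_pmf.expectation (K x) (\<lambda>z. h z / \<epsilon>)"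
      unfolding taboo_def using closed[OF that(1)] that(2) h_nonneg eps_pos
      by (intro expectation_K_mono) auto
    then show ?thesis
      by (simp only: sum_surv_Suc) simp
  qed
  have bound: "x \<in> X \<Longrightarrow> x \<noteq> e \<Longrightarrow> (\<Sum>n<M. surv n x) \<le> h x / \<epsilon>" for M x
  proof (induction M arbitrary: x)
    case 0
    then show ?case using h_nonneg eps_pos by simp
  next
    case (Suc M)
    have "1 + measure_pmf.expectation (K x) h / \<epsilon> \<le> h x / \<epsilon>"
      using divide_right_mono[OF drift[OF Suc.prems], of \<epsilon>] eps_pos by (simp add: diff_divide_distrib)
    then show ?case
      using step[OF Suc.prems(1) Suc.IH] by linarith
  qed
  then show "x \<noteq> e \<Longrightarrow> (\<Sum>n<M. surv n x) \<le> h x / \<epsilon>"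
    using assms by blast
  have "(\<Sum>n<M. surv n x) \<le> (\<Sum>n<Suc M. surv n x)"
    using surv_range by simp
  also have "\<dots> \<le> 1 + measure_pmf.expectation (K x) h / \<epsilon>"
    using assms bound by (intro step) auto
  finally show "(\<Sum>n<M. surv n x) \<le> 1 + measure_pmf.expectation (K x) h / \<epsilon>" .
qed

lemma summable_surv:
  assumes "x \<in> X"
  shows "summable (\<lambda>n. surv n x)"
proof (rule bounded_imp_summable)
  show "(\<Sum>k\<le>n. surv k x) \<le> 1 + measure_pmf.expectation (K x) h / \<epsilon>" for n
    using sum_surv_le(2)[OF assms, of "Suc n"] by (simp add: lessThan_Suc_atMost)
qed (rule surv_range)

lemma surv_tendsto_0: "x \<in> X \<Longrightarrow> (\<lambda>n. surv n x) \<longlonglongrightarrow> 0"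
  using summable_surv by (rule summable_LIMSEQ_zero)

lemma hit_prob_eq_1:
  assumes P: "\<And>x y. x \<in> X \<Longrightarrow> P x y = pmf (K x) y" and x: "x \<in> X"
  shows "hit_prob P x e = 1"
proof -
  have "(\<lambda>n. surv n x - surv (Suc n) x) sums (surv 0 x - 0)"
    by (rule telescope_sums') (rule surv_tendsto_0[OF x])
  then have "(\<lambda>n. fpt P (Suc n) x e) sums 1"
    by (simp add: fpt_eq_surv[OF P x] del: fpt.simps)
  then have "(\<lambda>n. fpt P n x e) sums 1"
    by (subst (asm) sums_Suc_iff) simp
  then show ?thesis
    unfolding hit_prob_def by (simp add: sums_iff)
qed

lemma pos_rec_state_e:
  assumes P: "\<And>x y. x \<in> X \<Longrightarrow> P x y = pmf (K x) y"
  shows "pos_rec_state P e"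
proof -
  \<comment> \<open>Summation by parts turns the cut-off mean of the return time into the sum of its
    tails. The boundary term has a minus sign, so dropping it keeps the upper bound.\<close>
  have by_parts: "(\<Sum>n<M. real (Suc n) * (surv n e - surv (Suc n) e))
      = (\<Sum>n<M. surv n e) - real M * surv M e" for M
    by (induction M) (simp_all add: algebra_simps)
  have "summable (\<lambda>n. real (Suc n) * (surv n e - surv (Suc n) e))"
  proof (rule bounded_imp_summable)
    fix M
    show "0 \<le> real (Suc M) * (surv M e - surv (Suc M) e)"
      using surv_decseq by simp
    show "(\<Sum>n\<le>M. real (Suc n) * (surv n e - surv (Suc n) e))
        \<le> 1 + measure_pmf.expectation (K e) h / \<epsilon>"
      using by_parts[of "Suc M"] sum_surv_le(2)[OF e_in, of "Suc M"] surv_range(1)[of "Suc M" e]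
        mult_nonneg_nonneg[OF of_nat_0_le_iff[of "Suc M"] surv_range(1)[of "Suc M" e]]
      unfolding lessThan_Suc_atMost by linarith
  qed
  then have "summable (\<lambda>n. real (Suc n) * fpt P (Suc n) e e)"
    by (simp add: fpt_eq_surv[OF P e_in] del: fpt.simps)
  then have "summable (\<lambda>n. real n * fpt P n e e)"
    by (subst (asm) summable_Suc_iff)
  then show ?thesis
    unfolding pos_rec_state_def using hit_prob_eq_1[OF P e_in] by simp
qed

section \<open>Uniqueness of the stationary law\<close>

lemma stationary_surv_tendsto_0:
  assumes supp: "set_pmf \<pi> \<subseteq> X"
  shows "(\<lambda>n. measure_pmf.expectation \<pi> (surv n)) \<longlonglongrightarrow> 0"
proof -
  have "(\<lambda>n. measure_pmf.expectation \<pi> (surv n)) \<longlonglongrightarrow> measure_pmf.expectation \<pi> (\<lambda>_. 0 :: real)"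
    using supp surv_tendsto_0 surv_range
    by (intro integral_dominated_convergence[where w="\<lambda>_. 1"]) (auto simp: AE_measure_pmf_iff)
  then show ?thesis by simp
qed

text \<open>For two stationary laws the signed functional \<open>\<pi>'{e} \<pi> - \<pi>{e} \<pi>'\<close> ignores the value at \<open>e\<close>, so it is
  invariant under the taboo operator, whose iterates tend to zero.\<close>
lemma stationary_proportional:
  fixes f :: "'a \<Rightarrow> real"
  assumes "bind_pmf \<pi> K = \<pi>" "set_pmf \<pi> \<subseteq> X" "bind_pmf \<pi>' K = \<pi>'" "set_pmf \<pi>' \<subseteq> X"
    and f: "\<And>z. 0 \<le> f z \<and> f z \<le> 1"
  shows "pmf \<pi>' e * measure_pmf.expectation \<pi> (\<lambda>z. if z = e then 0 else f z)
    = pmf \<pi> e * measure_pmf.expectation \<pi>' (\<lambda>z. if z = e then 0 else f z)"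
proof -
  define E where "E \<rho> g = measure_pmf.expectation \<rho> (\<lambda>z. if z = e then 0 else g z)"
    for \<rho> and g :: "'a \<Rightarrow> real"
  define D where "D g = pmf \<pi>' e * E \<pi> g - pmf \<pi> e * E \<pi>' g" for g
  have D_T: "D g = D (T g)" if "\<And>z. 0 \<le> g z \<and> g z \<le> 1" for g
    unfolding D_def E_def
    using stationary_taboo[OF assms(1,2) that] stationary_taboo[OF assms(3,4) that]
    by (simp add: algebra_simps)
  have D_iter: "D f = D ((T ^^ n) f)" for n
    by (induction n) (simp_all add: D_T[symmetric] taboo_iter_range[OF f])
  have E_bound: "0 \<le> E \<rho> ((T ^^ n) f) \<and> E \<rho> ((T ^^ n) f) \<le> measure_pmf.expectation \<rho> (surv n)" for \<rho> n
    unfolding E_def using taboo_iter_range[OF f] taboo_iter_le_surv[OF f] surv_range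
    by (auto intro!: Bochner_Integration.integral_nonneg integral_mono
        measure_pmf.integrable_const_bound[where B=1])
  have "\<bar>D f\<bar> \<le> measure_pmf.expectation \<pi> (surv n) + measure_pmf.expectation \<pi>' (surv n)" for n
  proof -
    have "0 \<le> pmf \<pi>' e * E \<pi> ((T ^^ n) f) \<and> pmf \<pi>' e * E \<pi> ((T ^^ n) f) \<le> 1 * measure_pmf.expectation \<pi> (surv n)"
      and "0 \<le> pmf \<pi> e * E \<pi>' ((T ^^ n) f) \<and> pmf \<pi> e * E \<pi>' ((T ^^ n) f) \<le> 1 * measure_pmf.expectation \<pi>' (surv n)"
      using E_bound[of \<pi> n] E_bound[of \<pi>' n]
      by (safe intro!: mult_nonneg_nonneg mult_mono pmf_le_1 pmf_nonneg zero_le_one)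
    then show ?thesis
      by (subst D_iter[of n]) (auto simp: D_def)
  qed
  moreover have "(\<lambda>n. measure_pmf.expectation \<pi> (surv n) + measure_pmf.expectation \<pi>' (surv n)) \<longlonglongrightarrow> 0 + 0"
    by (intro tendsto_add stationary_surv_tendsto_0 assms)
  ultimately have "\<bar>D f\<bar> \<le> 0 + 0"
    by (intro LIMSEQ_le_const) auto
  then show ?thesis by (simp add: D_def E_def)
qed

text \<open>Without mass at \<open>e\<close> there are no restarts, and stationarity would preserve
  the mean of \<open>surv n\<close>, which is 1 at \<open>n = 0\<close> but tends to 0.\<close>

lemma stationary_pmf_e_pos:
  assumes stat: "bind_pmf \<pi> K = \<pi>" and supp: "set_pmf \<pi> \<subseteq> X"
  shows "0 < pmf \<pi> e"
proof (rule ccontr)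
  assume "\<not> 0 < pmf \<pi> e"
  then have zero: "pmf \<pi> e = 0" using pmf_nonneg[of \<pi> e] by simp
  then have ne: "\<forall>z\<in>set_pmf \<pi>. z \<noteq> e"
    by (auto simp: set_pmf_iff)
  have off_e: "measure_pmf.expectation \<pi> (\<lambda>z. if z = e then 0 else f z) = measure_pmf.expectation \<pi> f"
    for f :: "'a \<Rightarrow> real"
    using ne by (intro integral_cong_AE) (auto simp: AE_measure_pmf_iff)
  have "measure_pmf.expectation \<pi> (surv n) = 1" for n
  proof (induction n)
    case (Suc n)
    then show ?case
      using stationary_taboo[OF stat supp, of "surv n"] surv_range
      by (simp add: off_e zero surv_Suc)
  qed simp
  then show False
    using stationary_surv_tendsto_0[OF supp] by (simp add: LIMSEQ_const_iff)
qed

lemma stationary_unique: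
  assumes "bind_pmf \<pi> K = \<pi>" "set_pmf \<pi> \<subseteq> X" "bind_pmf \<pi>' K = \<pi>'" "set_pmf \<pi>' \<subseteq> X"
  shows "\<pi> = \<pi>'"
proof -
  have mass: "measure_pmf.expectation \<rho> (\<lambda>z. if z = e then 0 else 1) = 1 - pmf \<rho> e" for \<rho>
  proof -
    have "measure_pmf.expectation \<rho> (\<lambda>z. if z = e then 0 else 1)
        = measure_pmf.expectation \<rho> (\<lambda>z. 1 - indicator {e} z)"
      by (intro Bochner_Integration.integral_cong) (auto simp: indicator_def)
    also have "\<dots> = 1 - pmf \<rho> e"
      by (subst Bochner_Integration.integral_diff)
        (auto simp: measure_pmf_single intro!: measure_pmf.integrable_const_bound[where B=1])
    finally show ?thesis .
  qed
  \<comment> \<open>For \<open>f = 1\<close> the proportionality reads x' (1 - x) = x (1 - x') for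
    the two masses at \<open>e\<close>, hence x = x'.\<close>
  have eq_e: "pmf \<pi> e = pmf \<pi>' e"
    using stationary_proportional[OF assms, of "\<lambda>_. 1"] by (simp add: mass algebra_simps)
  show ?thesis
  proof (rule pmf_eqI_except)
    fix y assume "y \<noteq> e"
    then have point: "measure_pmf.expectation \<rho> (\<lambda>z. if z = e then 0 else indicator {y} z) = pmf \<rho> y" for \<rho>
      by (subst integral_measure_pmf[of "{y}"]) (auto simp: indicator_def split: if_splits)
    show "pmf \<pi> y = pmf \<pi>' y"
      using stationary_proportional[OF assms, of "indicator {y}"] stationary_pmf_e_pos[OF assms(1,2)]
      by (simp add: point eq_e)
  qed
qed

text \<open>Law at time n of the chain started in \<open>e\<close>, restricted to no return so far.
  Extended nonnegative values let sums be exchanged before any of them is known to be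
  finite.\<close>

primrec occ :: "nat \<Rightarrow> 'a \<Rightarrow> ennreal" where
  "occ 0 y = indicator {e} y"
| "occ (Suc n) y = indicator (- {e}) y * (\<integral>\<^sup>+x. occ n x * ennreal (pmf (K x) y) \<partial>count_space UNIV)"

lemma nn_integral_count_space_swap:
  fixes f :: "'b \<Rightarrow> 'c \<Rightarrow> ennreal"
  shows "(\<integral>\<^sup>+x. \<integral>\<^sup>+y. f x y \<partial>count_space UNIV \<partial>count_space UNIV)
    = (\<integral>\<^sup>+y. \<integral>\<^sup>+x. f x y \<partial>count_space UNIV \<partial>count_space UNIV)"
  using nn_integral_fst_count_space[of "\<lambda>(x, y). f x y"] nn_integral_snd_count_space[of "\<lambda>(x, y). f x y"]
  by simp

text \<open>Duality: \<open>occ\<close> pushes mass forward, \<open>T\<close> pulls functions back,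
  and n steps from \<open>e\<close> can be charged to either side. For \<open>f = 1\<close> it gives
  \<open>occ n\<close> the total mass \<open>surv n e\<close>.\<close>

lemma nn_integral_occ:
  assumes "\<And>z. 0 \<le> f z \<and> f z \<le> 1"
  shows "(\<integral>\<^sup>+y. occ n y * ennreal (f y) \<partial>count_space UNIV) = ennreal ((T ^^ n) f e)"
  using assms
proof (induction n arbitrary: f)
  case 0
  have "(\<integral>\<^sup>+y. occ 0 y * ennreal (f y) \<partial>count_space UNIV)
      = (\<integral>\<^sup>+y. ennreal (f e) * indicator {e} y \<partial>count_space UNIV)"
    by (intro nn_integral_cong) (auto simp: indicator_def)
  then show ?case by simp
next
  case (Suc n)
  have inner: "(\<integral>\<^sup>+y. ennreal (pmf (K x) y) * ennreal (if y = e then 0 else f y) \<partial>count_space UNIV)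
      = ennreal (T f x)" for x
    unfolding taboo_def nn_integral_measure_pmf[symmetric]
    using Suc.prems by (intro nn_integral_eq_integral) auto
  have "(\<integral>\<^sup>+y. occ (Suc n) y * ennreal (f y) \<partial>count_space UNIV)
      = (\<integral>\<^sup>+y. \<integral>\<^sup>+x. occ n x * (ennreal (pmf (K x) y) * ennreal (if y = e then 0 else f y))
          \<partial>count_space UNIV \<partial>count_space UNIV)"
    by (intro nn_integral_cong)
      (auto simp: indicator_def nn_integral_multc[symmetric] mult.assoc)
  also have "\<dots> = (\<integral>\<^sup>+x. occ n x * ennreal (T f x) \<partial>count_space UNIV)"
    by (subst nn_integral_count_space_swap) (simp add: nn_integral_cmult inner)
  also have "\<dots> = ennreal ((T ^^ n) (T f) e)"
    using taboo_range[OF Suc.prems] by (rule Suc.IH)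
  finally show ?case
    by (simp add: funpow_swap1)
qed

lemma occ_outside: "y \<notin> X \<Longrightarrow> occ n y = 0"
proof (induction n arbitrary: y)
  case 0
  then show ?case using e_in by (auto simp: indicator_def)
next
  case (Suc n)
  have "occ n x * ennreal (pmf (K x) y) = 0" for x
  proof (cases "x \<in> X")
    case True
    then have "y \<notin> set_pmf (K x)" using closed Suc.prems by blast
    then show ?thesis by (simp add: set_pmf_iff)
  qed (simp add: Suc.IH)
  then have "(\<lambda>x. occ n x * ennreal (pmf (K x) y)) = (\<lambda>_. 0)" by blast
  then show ?case by (simp only: occ.simps) simp
qed

lemma stationary_exists: "\<exists>\<pi>. bind_pmf \<pi> K = \<pi> \<and> set_pmf \<pi> \<subseteq> X"
proof -
  define m where "m y = (\<Sum>n. occ n y)" for y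
  \<comment> \<open>The mean return time to \<open>e\<close>, which normalizes \<open>m\<close>; its
    term at n = 0 makes it at least 1.\<close>
  define M where "M = (\<Sum>n. surv n e)"
  have M_ge: "1 \<le> M"
    using sum_le_suminf[OF summable_surv[OF e_in], of "{0}"] surv_range by (simp add: M_def)
  have occ_mass: "(\<integral>\<^sup>+y. occ n y \<partial>count_space UNIV) = ennreal (surv n e)" for n
    using nn_integral_occ[of "\<lambda>_. 1" n] by (simp add: surv_def)
  have mass: "(\<integral>\<^sup>+y. m y \<partial>count_space UNIV) = ennreal M"
  proof -
    have "(\<integral>\<^sup>+y. m y \<partial>count_space UNIV) = (\<Sum>n. ennreal (surv n e))"
      unfolding m_def by (simp add: nn_integral_suminf occ_mass)
    also have "\<dots> = ennreal M"
      unfolding M_def using surv_range summable_surv[OF e_in] by (intro suminf_ennreal2) auto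
    finally show ?thesis .
  qed
  \<comment> \<open>Needed because \<open>enn2real\<close> would send an infinite value to
    0.\<close>
  have m_finite: "m y < \<infinity>" for y
  proof -
    have "m y = (\<integral>\<^sup>+z. m y * indicator {y} z \<partial>count_space UNIV)"
      by simp
    also have "\<dots> \<le> (\<integral>\<^sup>+z. m z \<partial>count_space UNIV)"
      by (intro nn_integral_mono) (auto simp: indicator_def)
    finally show ?thesis
      by (simp add: mass le_less_trans)
  qed
  define \<pi> where "\<pi> = embed_pmf (\<lambda>y. enn2real (m y) / M)"
  have enn: "ennreal (enn2real (m y) / M) = m y * ennreal (1 / M)" for y
    using M_ge m_finite[of y] by (simp add: divide_real_def ennreal_mult')
  have "(\<integral>\<^sup>+y. ennreal (enn2real (m y) / M) \<partial>count_space UNIV) = 1"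
    using M_ge by (simp add: enn nn_integral_multc mass ennreal_mult'[symmetric])
  then have pmf_\<pi>: "pmf \<pi> y = enn2real (m y) / M" for y
    unfolding \<pi>_def using M_ge by (intro pmf_embed_pmf) auto
  have pmf_\<pi>': "ennreal (pmf \<pi> y) = m y * ennreal (1 / M)" for y
    by (simp only: pmf_\<pi> enn)
  \<comment> \<open>Total mass 1 settles the point \<open>e\<close>. Elsewhere \<open>occ 0\<close>
    vanishes, so shifting the series by one step does not change it.\<close>
  have "bind_pmf \<pi> K = \<pi>"
  proof (rule pmf_eqI_except)
    fix y assume y: "y \<noteq> e"
    have "ennreal (pmf (bind_pmf \<pi> K) y)
        = (\<integral>\<^sup>+x. m x * ennreal (1 / M) * ennreal (pmf (K x) y) \<partial>count_space UNIV)"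
      by (simp only: ennreal_pmf_bind nn_integral_measure_pmf pmf_\<pi>')
    also have "\<dots> = (\<integral>\<^sup>+x. (\<Sum>n. occ n x * ennreal (pmf (K x) y)) * ennreal (1 / M) \<partial>count_space UNIV)"
      by (intro nn_integral_cong) (simp add: m_def ennreal_suminf_multc[symmetric] ac_simps)
    also have "\<dots> = (\<Sum>n. occ (Suc n) y) * ennreal (1 / M)"
      using y by (subst nn_integral_multc) (simp_all add: nn_integral_suminf del: ennreal_suminf_multc)
    also have "(\<Sum>n. occ (Suc n) y) = m y"
      using y suminf_offset[of "\<lambda>n. occ n y" 1] by (simp add: m_def)
    finally have "ennreal (pmf (bind_pmf \<pi> K) y) = ennreal (pmf \<pi> y)"
      by (simp only: pmf_\<pi>')
    then show "pmf (bind_pmf \<pi> K) y = pmf \<pi> y"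
      by (simp add: ennreal_inj)
  qed
  moreover have "set_pmf \<pi> \<subseteq> X"
    by (auto simp: set_pmf_iff pmf_\<pi> m_def occ_outside intro: ccontr)
  ultimately show ?thesis by blast
qed

end

section \<open>Uniformized chains with bounded rates\<close>

text \<open>The generator, written with increments so that constants are annihilated and the exit
  rate need not appear.\<close>

definition gen :: "('a \<Rightarrow> 'a \<Rightarrow> real) \<Rightarrow> ('a \<Rightarrow> real) \<Rightarrow> 'a \<Rightarrow> real" where
  "gen q F x = (\<Sum>y | q x y \<noteq> 0. q x y * (F y - F x))"

text \<open>\<open>ctmc_stationary\<close> is phrased with \<open>infsum\<close>, the kernel
  argument with integrals. Boundedness on \<open>X\<close> gives the absolute summability under
  which both agree.\<close>

lemma expectation_eq_infsum:
  fixes f :: "'a \<Rightarrow> real"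
  assumes supp: "set_pmf \<pi> \<subseteq> X" and bound: "\<And>x. x \<in> X \<Longrightarrow> \<bar>f x\<bar> \<le> B"
  shows "measure_pmf.expectation \<pi> f = (\<Sum>\<^sub>\<infinity>x\<in>X. pmf \<pi> x * f x)"
proof -
  define g where "g x = (if x \<in> X then f x else 0)" for x
  have "integrable (measure_pmf \<pi>) g"
    using bound by (intro measure_pmf.integrable_const_bound[where B="\<bar>B\<bar>"])
      (auto simp: g_def abs_le_iff intro!: AE_I2 order_trans[OF _ abs_ge_self])
  then have "Infinite_Set_Sum.abs_summable_on (\<lambda>x. pmf \<pi> x * g x) UNIV"
    by (simp add: Infinite_Set_Sum.abs_summable_on_def measure_pmf_eq_density integrable_density)
  then have "infsetsum (\<lambda>x. pmf \<pi> x * g x) UNIV = (\<Sum>\<^sub>\<infinity>x. pmf \<pi> x * g x)"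
    by (rule infsetsum_infsum)
  also have "\<dots> = (\<Sum>\<^sub>\<infinity>x\<in>X. pmf \<pi> x * f x)"
    by (rule infsum_cong_neutral) (auto simp: g_def)
  finally have "measure_pmf.expectation \<pi> g = (\<Sum>\<^sub>\<infinity>x\<in>X. pmf \<pi> x * f x)"
    by (simp add: pmf_expectation_eq_infsetsum)
  moreover have "measure_pmf.expectation \<pi> f = measure_pmf.expectation \<pi> g"
    using supp by (intro integral_cong_AE) (auto simp: AE_measure_pmf_iff g_def)
  ultimately show ?thesis by simp
qed

locale bounded_rates =
  fixes q :: "'a \<Rightarrow> 'a \<Rightarrow> real" and X :: "'a set" and \<Lambda> :: real
  assumes rate_nonneg: "x \<in> X \<Longrightarrow> 0 \<le> q x y"
    and rate_diag: "x \<in> X \<Longrightarrow> q x x = 0"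
    and finite_rates: "x \<in> X \<Longrightarrow> finite {y. q x y \<noteq> 0}"
    and rate_closed: "x \<in> X \<Longrightarrow> q x y \<noteq> 0 \<Longrightarrow> y \<in> X"
    and exit_le: "x \<in> X \<Longrightarrow> (\<Sum>y | q x y \<noteq> 0. q x y) \<le> \<Lambda>"
    and \<Lambda>_pos: "0 < \<Lambda>"
begin

text \<open>Outside \<open>X\<close> the row of \<open>unif\<close> may fail to be a distribution; a
  point mass keeps \<open>jump\<close> total with finite supports.\<close>

definition jump :: "'a \<Rightarrow> 'a pmf" where
  "jump x = (if x \<in> X then embed_pmf (unif \<Lambda> q x) else return_pmf x)"

lemma exit_rate_eq:
  assumes "x \<in> X"
  shows "exit_rate q x = (\<Sum>y | q x y \<noteq> 0. q x y)"
proof -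
  have "exit_rate q x = (\<Sum>\<^sub>\<infinity>y\<in>{y. q x y \<noteq> 0}. q x y)"
    unfolding exit_rate_def using rate_diag[OF assms] by (intro infsum_cong_neutral) auto
  then show ?thesis
    using finite_rates[OF assms] by simp
qed

lemma rate_le:
  assumes "x \<in> X"
  shows "q x y \<le> \<Lambda>"
proof (cases "q x y = 0")
  case False
  then have "q x y \<le> (\<Sum>y | q x y \<noteq> 0. q x y)"
    using finite_rates[OF assms] rate_nonneg[OF assms] by (intro member_le_sum) auto
  then show ?thesis using exit_le[OF assms] by linarith
qed (use \<Lambda>_pos in simp)

lemma unif_nonneg: "x \<in> X \<Longrightarrow> 0 \<le> unif \<Lambda> q x y"
  using exit_le[of x] \<Lambda>_pos rate_nonneg[of x] by (auto simp: unif_def exit_rate_eq)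

lemma sum_unif:
  assumes x: "x \<in> X"
  shows "(\<Sum>y\<in>insert x {y. q x y \<noteq> 0}. unif \<Lambda> q x y * F y) = F x + gen q F x / \<Lambda>"
proof -
  have "(\<Sum>y | q x y \<noteq> 0. unif \<Lambda> q x y * F y) = (\<Sum>y | q x y \<noteq> 0. q x y * F y) / \<Lambda>"
    using rate_diag[OF x] by (subst sum_divide_distrib) (intro sum.cong, auto simp: unif_def)
  moreover have "gen q F x = (\<Sum>y | q x y \<noteq> 0. q x y * F y) - exit_rate q x * F x"
    by (simp add: gen_def exit_rate_eq[OF x] right_diff_distrib sum_subtractf sum_distrib_right)
  ultimately show ?thesis
    using finite_rates[OF x] rate_diag[OF x] by (simp add: unif_def diff_divide_distrib left_diff_distrib)
qed

lemma pmf_jump: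
  assumes x: "x \<in> X"
  shows "pmf (jump x) y = unif \<Lambda> q x y"
proof -
  let ?S = "insert x {y. q x y \<noteq> 0}"
  have "(\<integral>\<^sup>+y. ennreal (unif \<Lambda> q x y) \<partial>count_space UNIV) = (\<Sum>y\<in>?S. ennreal (unif \<Lambda> q x y))"
    using finite_rates[OF x] by (intro nn_integral_count_space') (auto simp: unif_def)
  also have "\<dots> = ennreal (\<Sum>y\<in>?S. unif \<Lambda> q x y)"
    using unif_nonneg[OF x] by simp
  also have "(\<Sum>y\<in>?S. unif \<Lambda> q x y) = 1"
    using sum_unif[OF x, of "\<lambda>_. 1"] by (simp add: gen_def)
  finally show ?thesis
    using x unif_nonneg[OF x] by (simp add: jump_def pmf_embed_pmf)
qed

lemma set_pmf_jump: "x \<in> X \<Longrightarrow> set_pmf (jump x) \<subseteq> insert x {y. q x y \<noteq> 0}"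
  by (auto simp: set_pmf_iff pmf_jump unif_def split: if_splits)

lemma finite_set_pmf_jump: "finite (set_pmf (jump x))"
proof (cases "x \<in> X")
  case True
  then show ?thesis
    using finite_subset[OF set_pmf_jump[OF True]] finite_rates[OF True] by simp
qed (simp add: jump_def)

lemma expectation_jump:
  assumes x: "x \<in> X"
  shows "measure_pmf.expectation (jump x) F = F x + gen q F x / \<Lambda>"
  using sum_unif[OF x, of F] finite_rates[OF x] set_pmf_jump[OF x]
  by (subst integral_measure_pmf[of "insert x {y. q x y \<noteq> 0}"]) (auto simp: pmf_jump[OF x])

lemma finite_kernel_jump: "e \<in> X \<Longrightarrow> finite_kernel jump X e"
proof
  show "set_pmf (jump x) \<subseteq> X" if "x \<in> X" for x
    using set_pmf_jump[OF that] rate_closed[OF that] that by auto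
qed (simp_all add: finite_set_pmf_jump)

text \<open>The holding probability in \<open>unif\<close> contributes \<open>pmf \<pi> y\<close>
  less the outflow over \<open>\<Lambda>\<close>. The jump chain is therefore stationary exactly
  when the rates satisfy global balance.\<close>

lemma pmf_bind_jump:
  assumes supp: "set_pmf \<pi> \<subseteq> X" and y: "y \<in> X"
  shows "pmf (bind_pmf \<pi> jump) y
    = pmf \<pi> y + ((\<Sum>\<^sub>\<infinity>x\<in>X. pmf \<pi> x * q x y) - pmf \<pi> y * exit_rate q y) / \<Lambda>"
proof -
  have "pmf (bind_pmf \<pi> jump) y
      = measure_pmf.expectation \<pi> (\<lambda>x. indicator {y} x * (1 - exit_rate q y / \<Lambda>) + (if x \<in> X then q x y else 0) / \<Lambda>)"
    unfolding pmf_bind using supp rate_diag[OF y]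
    by (intro integral_cong_AE) (auto simp: AE_measure_pmf_iff pmf_jump unif_def indicator_def)
  also have "\<dots> = pmf \<pi> y * (1 - exit_rate q y / \<Lambda>)
      + measure_pmf.expectation \<pi> (\<lambda>x. if x \<in> X then q x y else 0) / \<Lambda>"
  proof (subst Bochner_Integration.integral_add)
    show "integrable (measure_pmf \<pi>) (\<lambda>x. indicator {y} x * (1 - exit_rate q y / \<Lambda>))"
      by (intro integrable_mult_left measure_pmf.integrable_const_bound[where B=1]) auto
    show "integrable (measure_pmf \<pi>) (\<lambda>x. (if x \<in> X then q x y else 0) / \<Lambda>)"
      using rate_nonneg rate_le \<Lambda>_pos
      by (intro integrable_divide measure_pmf.integrable_const_bound[where B=\<Lambda>]) auto
  qed (simp add: measure_pmf_single)
  also have "measure_pmf.expectation \<pi> (\<lambda>x. if x \<in> X then q x y else 0)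
      = (\<Sum>\<^sub>\<infinity>x\<in>X. pmf \<pi> x * (if x \<in> X then q x y else 0))"
    using rate_nonneg rate_le by (intro expectation_eq_infsum[OF supp, where B=\<Lambda>]) auto
  also have "\<dots> = (\<Sum>\<^sub>\<infinity>x\<in>X. pmf \<pi> x * q x y)"
    by (intro infsum_cong) auto
  finally show ?thesis
    by (simp add: algebra_simps diff_divide_distrib)
qed

lemma ctmc_stationary_iff:
  "ctmc_stationary q X \<pi> \<longleftrightarrow> bind_pmf \<pi> jump = \<pi> \<and> set_pmf \<pi> \<subseteq> X"
proof (cases "set_pmf \<pi> \<subseteq> X")
  case True
  have "set_pmf (bind_pmf \<pi> jump) \<subseteq> X"
    using True finite_kernel.closed[OF finite_kernel_jump] by fastforce
  then have "pmf (bind_pmf \<pi> jump) y = pmf \<pi> y" if "y \<notin> X" for y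
    using True that by (metis in_mono set_pmf_iff)
  then have "bind_pmf \<pi> jump = \<pi> \<longleftrightarrow> (\<forall>y\<in>X. pmf (bind_pmf \<pi> jump) y = pmf \<pi> y)"
    by (metis pmf_eqI)
  then show ?thesis
    using True \<Lambda>_pos by (simp add: ctmc_stationary_def pmf_bind_jump)
qed (simp add: ctmc_stationary_def)

text \<open>Source of all moment estimates. \<open>F\<close> may be unbounded, because on
  \<open>X\<close> the function \<open>gen q F\<close> is \<open>\<Lambda>\<close> times the mean
  one-step increment of the jump chain.\<close>

lemma stationary_gen:
  fixes F :: "'a \<Rightarrow> real"
  assumes stat: "ctmc_stationary q X \<pi>"
    and nonneg: "\<And>x. x \<in> X \<Longrightarrow> 0 \<le> F x" and int: "integrable (measure_pmf \<pi>) F"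
  shows "integrable (measure_pmf \<pi>) (gen q F)"
    and "measure_pmf.expectation \<pi> (gen q F) = 0"
proof -
  have bind: "bind_pmf \<pi> jump = \<pi>" and supp: "set_pmf \<pi> \<subseteq> X"
    using stat by (auto simp: ctmc_stationary_iff)
  from supp obtain e where "e \<in> X"
    using set_pmf_not_empty[of \<pi>] by blast
  then interpret finite_kernel jump X e
    by (rule finite_kernel_jump)
  note stat_exp = stationary_expectation[OF bind supp nonneg int]
  have AE: "AE x in \<pi>. gen q F x = \<Lambda> * (measure_pmf.expectation (jump x) F - F x)"
    using supp \<Lambda>_pos by (auto simp: AE_measure_pmf_iff expectation_jump)
  show "integrable (measure_pmf \<pi>) (gen q F)"
    using stat_exp(1) int by (subst integrable_cong_AE[OF _ _ AE]) auto
  show "measure_pmf.expectation \<pi> (gen q F) = 0"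
    using stat_exp int by (subst integral_cong_AE[OF _ _ AE]) auto
qed

lemma foster:
  assumes e: "e \<in> X" and h: "\<And>x. x \<in> X \<Longrightarrow> 0 \<le> h x" and \<epsilon>: "0 < \<epsilon>"
    and drift: "\<And>x. x \<in> X \<Longrightarrow> x \<noteq> e \<Longrightarrow> gen q h x \<le> - \<epsilon>"
  shows "ctmc_pos_recurrent \<Lambda> q X" and "\<exists>!\<pi>. ctmc_stationary q X \<pi>"
proof -
  interpret finite_kernel jump X e
    using e by (rule finite_kernel_jump)
  interpret foster_kernel jump X e h "\<epsilon> / \<Lambda>"
  proof
    show "measure_pmf.expectation (jump x) h \<le> h x - \<epsilon> / \<Lambda>" if "x \<in> X" "x \<noteq> e" for x
      using divide_right_mono[OF drift[OF that], of \<Lambda>] \<Lambda>_pos by (simp add: expectation_jump that)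
  qed (use h \<epsilon> \<Lambda>_pos in auto)
  have P: "unif \<Lambda> q x y = pmf (jump x) y" if "x \<in> X" for x y
    by (simp add: pmf_jump that)
  show "ctmc_pos_recurrent \<Lambda> q X"
    unfolding ctmc_pos_recurrent_def using e pos_rec_state_e[OF P] hit_prob_eq_1[OF P] by blast
  show "\<exists>!\<pi>. ctmc_stationary q X \<pi>"
    using stationary_exists stationary_unique by (auto simp: ctmc_stationary_iff intro!: ex_ex1I)
qed

end

section \<open>The rates of the station system\<close>

lemma gen_sum: "gen q (\<lambda>y. \<Sum>i\<in>I. F i y) x = (\<Sum>i\<in>I. gen q (F i) x)"
  unfolding gen_def
  by (subst sum.swap) (simp add: sum_subtractf[symmetric] sum_distrib_left)

lemma gen_add: "gen q (\<lambda>y. F y + G y) x = gen q F x + gen q G x"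
  by (simp add: gen_def sum.distrib[symmetric] algebra_simps)

lemma gen_cong:
  assumes "F x = G x" "\<And>y. q x y \<noteq> 0 \<Longrightarrow> F y = G y"
  shows "gen q F x = gen q G x"
  unfolding gen_def using assms by (intro sum.cong) auto

text \<open>A move at level i alters coordinate j exactly when j \<le> i. The rates of the moves are
  differences of levels, so their sum over all such i telescopes.\<close>

lemma sum_telescope_above:
  fixes f :: "nat \<Rightarrow> real"
  assumes "1 \<le> j" "\<forall>i\<ge>m. f i = 0"
  shows "(\<Sum>i\<in>{1..m}. if j \<le> i then f (i - 1) - f i else 0) = f (j - 1)"
    and "(\<Sum>i\<in>{1..m}. if j \<le> i then f i - f (Suc i) else 0) = f j"
proof -
  have set: "{i \<in> {1..m}. j \<le> i} = {j..m}" using assms(1) by auto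
  show "(\<Sum>i\<in>{1..m}. if j \<le> i then f (i - 1) - f i else 0) = f (j - 1)"
  proof (cases "j \<le> m")
    case True
    have "(\<Sum>i\<in>{1..m}. if j \<le> i then f (i - 1) - f i else 0) = (\<Sum>i\<in>{j..m}. f (i - 1) - f i)"
      by (subst sum.inter_filter[symmetric]) (simp_all only: set finite_atLeastAtMost)
    also have "\<dots> = - (\<Sum>i\<in>{Suc (j - 1)..m}. f i - f (i - 1))"
      using assms(1) by (simp add: sum_negf[symmetric])
    also have "\<dots> = f (j - 1)"
      using True assms by (subst sum_telescope'') auto
    finally show ?thesis .
  qed (use assms in auto)
  show "(\<Sum>i\<in>{1..m}. if j \<le> i then f i - f (Suc i) else 0) = f j"
  proof (cases "j \<le> m")
    case True
    have "(\<Sum>i\<in>{1..m}. if j \<le> i then f i - f (Suc i) else 0) = (\<Sum>i\<in>{j..m}. f i - f (Suc i))"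
      by (subst sum.inter_filter[symmetric]) (simp_all only: set finite_atLeastAtMost)
    also have "\<dots> = - (\<Sum>i\<in>{j..m}. f (Suc i) - f i)"
      by (simp add: sum_negf[symmetric])
    also have "\<dots> = f j"
      using True assms by (subst sum_Suc_diff) auto
    finally show ?thesis .
  qed (use assms in auto)
qed

section \<open>Level counts of a queue-length configuration\<close>

lemma S_of_eq_sum: "S_of N Q i = (\<Sum>n<N. of_bool (i \<le> Q n)) / real N"
proof -
  have "{n. n < N \<and> i \<le> Q n} = {..<N} \<inter> {n. i \<le> Q n}" by auto
  then show ?thesis by (simp add: S_of_def)
qed

text \<open>A station with queue \<open>Q n\<close> occupies the levels from \<open>i\<close> to
  \<open>Q n\<close>, which are \<open>Suc (Q n) - i\<close> many; truncated subtraction gives 0 for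
  shorter queues.\<close>

lemma S_of_sums: "(\<lambda>j. S_of N Q (i + j)) sums ((\<Sum>n<N. real (Suc (Q n) - i)) / real N)"
proof -
  have "(\<lambda>j. of_bool (i + j \<le> Q n) :: real) sums real (Suc (Q n) - i)" for n
  proof -
    have "(\<Sum>j<Suc (Q n) - i. of_bool (i + j \<le> Q n)) = (\<Sum>j<Suc (Q n) - i. 1 :: real)"
      by (intro sum.cong) auto
    then show ?thesis
      using sums_finite[of "{..<Suc (Q n) - i}" "\<lambda>j. of_bool (i + j \<le> Q n) :: real"] by simp
  qed
  then show ?thesis
    unfolding S_of_eq_sum by (intro sums_divide sums_sum)
qed

lemma V_of_eq: "V_of N Q i = (\<Sum>n<N. real (Suc (Q n) - i)) / real N"
  unfolding V_of_def using S_of_sums by (simp add: sums_iff)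

lemma s_of_V_of: "s_of_v (V_of N Q) = S_of N Q"
proof
  fix i
  have "real (Suc (Q n) - i) - real (Suc (Q n) - Suc i) = of_bool (i \<le> Q n)" for n
    by auto
  then show "s_of_v (V_of N Q) i = S_of N Q i"
    by (simp add: s_of_v_def V_of_eq S_of_eq_sum diff_divide_distrib[symmetric] sum_subtractf[symmetric])
qed

lemma S_of_eventually_0: "\<exists>m. \<forall>i\<ge>m. S_of N Q i = 0"
proof -
  have "Q n \<le> (\<Sum>n<N. Q n)" if "n < N" for n
    using that by (intro member_le_sum) auto
  then have "S_of N Q i = 0" if "Suc (\<Sum>n<N. Q n) \<le> i" for i
    unfolding S_of_eq_sum using that by (fastforce intro!: sum.neutral simp: not_le)
  then show ?thesis by blast
qed

locale system =
  fixes lam p :: real and N :: nat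
  assumes lam: "0 \<le> lam" "lam < 1" and p: "0 \<le> p" "p \<le> 1" and N: "1 \<le> N"
begin

abbreviation q where "q \<equiv> qV lam p N"
abbreviation st where "st \<equiv> XV N"

lemma vup_V_of:
  assumes "n < N"
  shows "vup N (Suc (Q n)) (V_of N Q) = V_of N (Q(n := Suc (Q n)))"
proof
  fix i
  have "(\<Sum>k<N. real (Suc ((Q(n := Suc (Q n))) k) - i))
      = (\<Sum>k<N. real (Suc (Q k) - i) + (if k = n then of_bool (i \<le> Suc (Q n)) else 0))"
    by (intro sum.cong) auto
  also have "\<dots> = (\<Sum>k<N. real (Suc (Q k) - i)) + of_bool (i \<le> Suc (Q n))"
    using assms by (simp add: sum.distrib)
  finally show "vup N (Suc (Q n)) (V_of N Q) i = V_of N (Q(n := Suc (Q n))) i"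
    by (simp add: vup_def V_of_eq add_divide_distrib)
qed

lemma vdown_vup: "vdown N i (vup N i v) = v"
  by (auto simp: vup_def vdown_def)

text \<open>A jump with positive rate needs a station sitting exactly at the level that it leaves;
  this station shows that the target is again a configuration.\<close>

lemma level_exists:
  assumes "S_of N Q (Suc i) < S_of N Q i"
  obtains n where "n < N" "Q n = i"
proof -
  have "\<exists>n<N. Q n = i"
  proof (rule ccontr)
    assume "\<not> (\<exists>n<N. Q n = i)"
    then have "{n. n < N \<and> Q n \<ge> i} = {n. n < N \<and> Q n \<ge> Suc i}"
      by (auto simp: Suc_le_eq le_less)
    with assms show False by (simp add: S_of_def)
  qed
  then show ?thesis using that by blast
qed

lemma vup_in:
  assumes "v \<in> st" "1 \<le> i" "s_of_v v i < s_of_v v (i - 1)"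
  shows "vup N i v \<in> st"
proof -
  obtain Q where v: "v = V_of N Q" using assms(1) by (auto simp: XV_def)
  obtain n where "n < N" "Q n = i - 1"
    using level_exists[of Q "i - 1"] assms(2,3) by (auto simp: v s_of_V_of)
  then have "vup N i v = V_of N (Q(n := Suc (Q n)))"
    using vup_V_of[of n Q] assms(2) by (simp add: v)
  then show ?thesis by (auto simp: XV_def)
qed

lemma vdown_in:
  assumes "v \<in> st" "1 \<le> i" "s_of_v v (Suc i) < s_of_v v i"
  shows "vdown N i v \<in> st"
proof -
  obtain Q where v: "v = V_of N Q" using assms(1) by (auto simp: XV_def)
  obtain n where n: "n < N" "Q n = i"
    using level_exists[of Q i] assms(3) by (auto simp: v s_of_V_of)
  define Q' where "Q' = Q(n := i - 1)"
  have "vup N i (V_of N Q') = v"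
    using vup_V_of[of n Q'] n assms(2) by (simp add: v Q'_def fun_upd_idem)
  then have "vdown N i v = V_of N Q'"
    using vdown_vup by metis
  then show ?thesis by (auto simp: XV_def)
qed

context
  fixes v assumes v: "v \<in> st"
begin

lemma s_zero: "s_of_v v 0 = 1"
  using v N by (auto simp: XV_def s_of_V_of S_of_def)

lemma s_antimono: "i \<le> j \<Longrightarrow> s_of_v v j \<le> s_of_v v i"
  using v by (auto simp: XV_def s_of_V_of S_of_def intro!: divide_right_mono card_mono)

lemma s_range: "0 \<le> s_of_v v i" "s_of_v v i \<le> 1"
  using s_antimono[of 0 i] s_zero v by (auto simp: XV_def s_of_V_of S_of_def)

lemma s_pos_ge: "0 < s_of_v v i \<Longrightarrow> 1 \<le> real N * s_of_v v i"
  using v N by (auto simp: XV_def s_of_V_of S_of_def zero_less_divide_iff)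

lemma s_eventually_0: "\<exists>m. \<forall>i\<ge>m. s_of_v v i = 0"
  using v S_of_eventually_0 by (auto simp: XV_def s_of_V_of)

lemma s_sums: "(\<lambda>j. s_of_v v (i + j)) sums v i"
  using v S_of_sums by (auto simp: XV_def s_of_V_of V_of_eq)

lemma v_nonneg: "0 \<le> v i"
  by (rule sums_le[OF _ sums_zero s_sums]) (rule s_range(1))

lemma s_le_v: "s_of_v v i \<le> v i"
  using v_nonneg[of "Suc i"] by (simp add: s_of_v_def)

lemma v_antimono: "i \<le> j \<Longrightarrow> v j \<le> v i"
proof (rule lift_Suc_antimono_le[of v])
  show "v (Suc n) \<le> v n" for n
    using s_range(1)[of n] by (simp add: s_of_v_def)
qed

lemma v_zero: "v 0 = 1 + v 1"
  using s_zero by (simp add: s_of_v_def)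

lemma v_eq_0: 
  assumes "\<And>j. i \<le> j \<Longrightarrow> s_of_v v j = 0"
  shows "v i = 0"
  using s_sums[of i] assms by (simp add: sums_iff)

lemma v_pos_iff: "0 < v i \<longleftrightarrow> 0 < s_of_v v i"
proof
  assume "0 < v i"
  show "0 < s_of_v v i"
  proof (rule ccontr)
    assume "\<not> 0 < s_of_v v i"
    then have "s_of_v v j = 0" if "i \<le> j" for j
      using s_antimono[OF that] s_range(1)[of j] by simp
    then show False using v_eq_0 \<open>0 < v i\<close> by fastforce
  qed
qed (use s_le_v[of i] in simp)

text \<open>Levels vanish eventually, so the greatest occupied one exists, and by monotonicity all
  levels up to it are occupied. A departure from a longest queue thus lowers \<open>v j\<close>
  exactly when level j is occupied, however long that queue is.\<close>

lemma top_level: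
  assumes "0 < v 1"
  defines "L \<equiv> GREATEST i. 0 < s_of_v v i"
  shows "j \<le> L \<longleftrightarrow> 0 < s_of_v v j" and "s_of_v v (Suc L) < s_of_v v L" and "1 \<le> L"
proof -
  obtain m where m: "\<forall>i\<ge>m. s_of_v v i = 0" using s_eventually_0 by blast
  have bound: "i \<le> m" if "0 < s_of_v v i" for i
  proof (rule ccontr)
    assume "\<not> i \<le> m"
    then have "s_of_v v i = 0" using m by simp
    with that show False by simp
  qed
  have pos: "0 < s_of_v v L"
    unfolding L_def using assms(1) bound
    by (intro GreatestI_nat[where P="\<lambda>i. 0 < s_of_v v i" and k=1 and b=m]) (simp_all add: v_pos_iff)
  have le: "i \<le> L" if "0 < s_of_v v i" for i
    unfolding L_def using bound that
    by (intro Greatest_le_nat[where P="\<lambda>i. 0 < s_of_v v i" and b=m]) auto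
  show iff: "j \<le> L \<longleftrightarrow> 0 < s_of_v v j" for j
    using le[of j] pos s_antimono[of j L] by linarith
  show "s_of_v v (Suc L) < s_of_v v L"
    using iff[of "Suc L"] pos by simp
  show "1 \<le> L" using assms(1) le by (simp add: v_pos_iff)
qed

end

lemma vup_neq: "vup N i v \<noteq> v" and vdown_neq: "vdown N i v \<noteq> v"
  using N by (auto simp: vup_def vdown_def fun_eq_iff)

text \<open>Injectivity keeps the index sets in \<open>qV\<close> finite; a sum over an infinite set
  would be 0 by convention.\<close>

lemma inj_vup: "inj (\<lambda>i. vup N i v)"
proof (rule linorder_injI)
  fix i j :: nat assume "i < j"
  then have "vup N i v j \<noteq> vup N j v j" using N by (simp add: vup_def)
  then show "vup N i v \<noteq> vup N j v" by (rule contrapos_nn) (rule fun_cong)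
qed

lemma inj_vdown: "inj (\<lambda>i. vdown N i v)"
proof (rule linorder_injI)
  fix i j :: nat assume "i < j"
  then have "vdown N i v j \<noteq> vdown N j v j" using N by (simp add: vdown_def)
  then show "vdown N i v \<noteq> vdown N j v" by (rule contrapos_nn) (rule fun_cong)
qed

definition top_lev where "top_lev v = (GREATEST i. 0 < s_of_v v i)"

text \<open>When all levels from \<open>m\<close> on are empty, jumps at levels above
  \<open>m\<close> have rate 0, so this finite set contains every state reachable in one
  jump.\<close>

definition nbrs where
  "nbrs m v = (\<lambda>i. vup N i v) ` {1..m} \<union> (\<lambda>i. vdown N i v) ` {1..m}
     \<union> (if 0 < v 1 then {vdown N (top_lev v) v} else {})"

lemma finite_nbrs: "finite (nbrs m v)"
  by (simp add: nbrs_def)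

context
  fixes v m assumes v: "v \<in> st" and m: "\<forall>i\<ge>m. s_of_v v i = 0"
begin

lemma qV_eq:
  assumes "w \<noteq> v"
  shows "q v w = (\<Sum>i\<in>{i \<in> {1..m}. vup N i v = w}. lam * real N * (s_of_v v (i - 1) - s_of_v v i))
    + (\<Sum>i\<in>{i \<in> {1..m}. vdown N i v = w}. (1 - p) * real N * (s_of_v v i - s_of_v v (Suc i)))
    + (if 0 < v 1 \<and> vdown N (top_lev v) v = w then real N * p else 0)"
proof -
  have fin: "finite {i. 1 \<le> i \<and> f i = w}" if "inj f" for f :: "nat \<Rightarrow> nat \<Rightarrow> real"
    by (rule finite_subset[OF _ finite_vimageI[OF _ that, of "{w}"]]) auto
  have "(\<Sum>i\<in>{i. 1 \<le> i \<and> vup N i v = w}. lam * real N * (s_of_v v (i - 1) - s_of_v v i))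
      = (\<Sum>i\<in>{i \<in> {1..m}. vup N i v = w}. lam * real N * (s_of_v v (i - 1) - s_of_v v i))"
  proof (intro sum.mono_neutral_right fin inj_vup)
    have "lam * real N * (s_of_v v (i - 1) - s_of_v v i) = 0" if "1 \<le> i" "\<not> i \<le> m" for i
      using that m by simp
    then show "\<forall>i\<in>{i. 1 \<le> i \<and> vup N i v = w} - {i \<in> {1..m}. vup N i v = w}.
        lam * real N * (s_of_v v (i - 1) - s_of_v v i) = 0"
      unfolding atLeastAtMost_iff by blast
  qed auto
  moreover have "(\<Sum>i\<in>{i. 1 \<le> i \<and> vdown N i v = w}. (1 - p) * real N * (s_of_v v i - s_of_v v (Suc i)))
      = (\<Sum>i\<in>{i \<in> {1..m}. vdown N i v = w}. (1 - p) * real N * (s_of_v v i - s_of_v v (Suc i)))"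
  proof (intro sum.mono_neutral_right fin inj_vdown)
    have "(1 - p) * real N * (s_of_v v i - s_of_v v (Suc i)) = 0" if "\<not> i \<le> m" for i
      using that m by simp
    then show "\<forall>i\<in>{i. 1 \<le> i \<and> vdown N i v = w} - {i \<in> {1..m}. vdown N i v = w}.
        (1 - p) * real N * (s_of_v v i - s_of_v v (Suc i)) = 0"
      unfolding atLeastAtMost_iff by blast
  qed auto
  ultimately show ?thesis
    unfolding qV_def top_lev_def using assms by (simp only: if_False)
qed

lemma qV_nonneg: "0 \<le> q v w"
proof (cases "w = v")
  case False
  have "0 \<le> lam * real N * (s_of_v v (i - 1) - s_of_v v i)"
    and "0 \<le> (1 - p) * real N * (s_of_v v i - s_of_v v (Suc i))" for i
    using lam p s_antimono[OF v, of "i - 1" i] s_antimono[OF v, of i "Suc i"] by simp_all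
  then show ?thesis
    unfolding qV_eq[OF False] using p by (intro add_nonneg_nonneg sum_nonneg) simp_all
qed (simp add: qV_def)

lemma qV_support: "q v w \<noteq> 0 \<Longrightarrow> w \<in> nbrs m v"
proof (rule ccontr)
  assume w: "q v w \<noteq> 0" "w \<notin> nbrs m v"
  have ne: "w \<noteq> v" using w(1) by (auto simp: qV_def)
  have up: "{i \<in> {1..m}. vup N i v = w} = {}" and down: "{i \<in> {1..m}. vdown N i v = w} = {}"
    and "\<not> (0 < v 1 \<and> vdown N (top_lev v) v = w)"
    using w(2) by (auto simp: nbrs_def split: if_splits)
  with w(1) show False
    by (simp only: qV_eq[OF ne] up down sum.empty) auto
qed

lemma finite_qV_support: "finite {w. q v w \<noteq> 0}"
  by (rule finite_subset[OF _ finite_nbrs[of m v]]) (auto dest: qV_support)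

lemma qV_closed:
  assumes "q v w \<noteq> 0"
  shows "w \<in> st"
proof -
  have ne: "w \<noteq> v" using assms by (auto simp: qV_def)
  \<comment> \<open>One of the three kinds of jump is active: arrival, local departure or central
    departure.\<close>
  have "a \<noteq> 0 \<or> b \<noteq> 0 \<or> P" if "a + b + (if P then c else 0) \<noteq> 0" for a b c :: real and P
    using that by (cases P) auto
  from this[OF assms[unfolded qV_eq[OF ne]]] show ?thesis
  proof (elim disjE, goal_cases)
    case 1
    then obtain i where "1 \<le> i" "vup N i v = w" "s_of_v v (i - 1) \<noteq> s_of_v v i"
      by (elim sum.not_neutral_contains_not_neutral) auto
    then show ?thesis
      using vup_in[OF v, of i] s_antimono[OF v, of "i - 1" i] by auto
  next
    case 2
    then obtain i where "1 \<le> i" "vdown N i v = w" "s_of_v v (Suc i) \<noteq> s_of_v v i"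
      by (elim sum.not_neutral_contains_not_neutral) auto
    then show ?thesis
      using vdown_in[OF v, of i] s_antimono[OF v, of i "Suc i"] by auto
  next
    case 3
    then show ?thesis
      using vdown_in[OF v, of "top_lev v"] top_level[OF v] by (auto simp: top_lev_def)
  qed
qed

text \<open>Sums over target states become sums over transitions. Transitions may share a target, as
  local and central departures from the top level do, so terms are grouped by target.
  \<open>G v = 0\<close> covers \<open>w = v\<close>, where \<open>qV\<close> is set to 0.\<close>

lemma qV_sum:
  assumes "G v = 0"
  shows "(\<Sum>w | q v w \<noteq> 0. q v w * G w)
    = (\<Sum>i\<in>{1..m}. lam * real N * (s_of_v v (i - 1) - s_of_v v i) * G (vup N i v))
    + (\<Sum>i\<in>{1..m}. (1 - p) * real N * (s_of_v v i - s_of_v v (Suc i)) * G (vdown N i v))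
    + (if 0 < v 1 then real N * p * G (vdown N (top_lev v) v) else 0)"
proof -
  let ?W = "nbrs m v"
  let ?a = "\<lambda>i. lam * real N * (s_of_v v (i - 1) - s_of_v v i)"
  let ?b = "\<lambda>i. (1 - p) * real N * (s_of_v v i - s_of_v v (Suc i))"
  have "(\<Sum>w | q v w \<noteq> 0. q v w * G w) = (\<Sum>w\<in>?W. q v w * G w)"
    using qV_support finite_nbrs by (intro sum.mono_neutral_left) auto
  also have "\<dots> = (\<Sum>w\<in>?W. (\<Sum>i\<in>{i \<in> {1..m}. vup N i v = w}. ?a i * G (vup N i v))
      + (\<Sum>i\<in>{i \<in> {1..m}. vdown N i v = w}. ?b i * G (vdown N i v))
      + (if vdown N (top_lev v) v = w then if 0 < v 1 then real N * p * G (vdown N (top_lev v) v) else 0 else 0))"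
  proof (rule sum.cong[OF refl])
    fix w assume "w \<in> ?W"
    have up: "(\<Sum>i\<in>{i \<in> {1..m}. vup N i v = w}. ?a i * G (vup N i v))
        = (\<Sum>i\<in>{i \<in> {1..m}. vup N i v = w}. ?a i) * G w"
      by (subst sum_distrib_right) (rule sum.cong, auto)
    have down: "(\<Sum>i\<in>{i \<in> {1..m}. vdown N i v = w}. ?b i * G (vdown N i v))
        = (\<Sum>i\<in>{i \<in> {1..m}. vdown N i v = w}. ?b i) * G w"
      by (subst sum_distrib_right) (rule sum.cong, auto)
    show "q v w * G w = (\<Sum>i\<in>{i \<in> {1..m}. vup N i v = w}. ?a i * G (vup N i v))
      + (\<Sum>i\<in>{i \<in> {1..m}. vdown N i v = w}. ?b i * G (vdown N i v))
      + (if vdown N (top_lev v) v = w then if 0 < v 1 then real N * p * G (vdown N (top_lev v) v) else 0 else 0)"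
      unfolding up down
      by (cases "w = v") (auto simp: assms qV_eq distrib_right)
  qed
  also have "\<dots> = (\<Sum>i\<in>{1..m}. ?a i * G (vup N i v)) + (\<Sum>i\<in>{1..m}. ?b i * G (vdown N i v))
      + (if 0 < v 1 then real N * p * G (vdown N (top_lev v) v) else 0)"
  proof -
    have "(\<Sum>w\<in>?W. \<Sum>i\<in>{i \<in> {1..m}. vup N i v = w}. ?a i * G (vup N i v))
        = (\<Sum>i\<in>{1..m}. ?a i * G (vup N i v))"
      by (intro sum.group finite_nbrs) (auto simp: nbrs_def)
    moreover have "(\<Sum>w\<in>?W. \<Sum>i\<in>{i \<in> {1..m}. vdown N i v = w}. ?b i * G (vdown N i v))
        = (\<Sum>i\<in>{1..m}. ?b i * G (vdown N i v))"
      by (intro sum.group finite_nbrs) (auto simp: nbrs_def)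
    moreover have "(\<Sum>w\<in>?W. if vdown N (top_lev v) v = w then if 0 < v 1 then real N * p * G (vdown N (top_lev v) v) else 0 else 0)
        = (if 0 < v 1 then real N * p * G (vdown N (top_lev v) v) else 0)"
    proof (cases "0 < v 1")
      case True
      then have "vdown N (top_lev v) v \<in> ?W" by (simp add: nbrs_def)
      then show ?thesis using True finite_nbrs by (simp only: sum.delta' if_True)
    qed simp
    ultimately show ?thesis by (simp only: sum.distrib)
  qed
  finally show ?thesis .
qed

lemma coordinate_sum:
  assumes j: "1 \<le> j"
  shows "(\<Sum>i\<in>{1..m}. lam * real N * (s_of_v v (i - 1) - s_of_v v i) * (if j \<le> i then c else 0))
      = lam * real N * s_of_v v (j - 1) * c"
    and "(\<Sum>i\<in>{1..m}. (1 - p) * real N * (s_of_v v i - s_of_v v (Suc i)) * (if j \<le> i then c else 0))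
      = (1 - p) * real N * s_of_v v j * c"
proof -
  have "(\<Sum>i\<in>{1..m}. a * f i * (if j \<le> i then c else 0)) = a * (\<Sum>i\<in>{1..m}. if j \<le> i then f i else 0) * c"
    for a :: real and f
    by (subst sum_distrib_left, subst sum_distrib_right) (rule sum.cong, auto)
  then show "(\<Sum>i\<in>{1..m}. lam * real N * (s_of_v v (i - 1) - s_of_v v i) * (if j \<le> i then c else 0))
      = lam * real N * s_of_v v (j - 1) * c"
    and "(\<Sum>i\<in>{1..m}. (1 - p) * real N * (s_of_v v i - s_of_v v (Suc i)) * (if j \<le> i then c else 0))
      = (1 - p) * real N * s_of_v v j * c"
    by (simp_all only: sum_telescope_above[OF j m])
qed

text \<open>A function of one coordinate sees a birth-death process with steps 1 / N: arrivals at
  stations with at least j - 1 tasks, departures from stations with at least j. By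
  \<open>top_level\<close> the central clock enters through an indicator only. All drift estimates
  start here.\<close>

lemma gen_coord:
  assumes j: "1 \<le> j"
  shows "gen q (\<lambda>v. \<phi> (v j)) v
    = lam * real N * s_of_v v (j - 1) * (\<phi> (v j + 1 / real N) - \<phi> (v j))
    + ((1 - p) * real N * s_of_v v j + real N * p * of_bool (0 < s_of_v v j)) * (\<phi> (v j - 1 / real N) - \<phi> (v j))"
proof -
  have up: "\<phi> (vup N i v j) - \<phi> (v j) = (if j \<le> i then \<phi> (v j + 1 / real N) - \<phi> (v j) else 0)" for i
    by (simp add: vup_def)
  have down: "\<phi> (vdown N i v j) - \<phi> (v j) = (if j \<le> i then \<phi> (v j - 1 / real N) - \<phi> (v j) else 0)" for i
    by (simp add: vdown_def)
  have central: "(if 0 < v 1 then real N * p * (\<phi> (vdown N (top_lev v) v j) - \<phi> (v j)) else 0)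
      = real N * p * of_bool (0 < s_of_v v j) * (\<phi> (v j - 1 / real N) - \<phi> (v j))"
  proof (cases "0 < v 1")
    case True
    then have "j \<le> top_lev v \<longleftrightarrow> 0 < s_of_v v j"
      unfolding top_lev_def by (rule top_level(1)[OF v])
    then show ?thesis
      unfolding down using True by (simp only: if_True) simp
  next
    case False
    then have "\<not> 0 < s_of_v v j"
      using v_pos_iff[OF v, of 1] s_antimono[OF v j] by linarith
    then show ?thesis using False by simp
  qed
  have "gen q (\<lambda>v. \<phi> (v j)) v
    = (\<Sum>i\<in>{1..m}. lam * real N * (s_of_v v (i - 1) - s_of_v v i) * (\<phi> (vup N i v j) - \<phi> (v j)))
    + (\<Sum>i\<in>{1..m}. (1 - p) * real N * (s_of_v v i - s_of_v v (Suc i)) * (\<phi> (vdown N i v j) - \<phi> (v j)))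
    + (if 0 < v 1 then real N * p * (\<phi> (vdown N (top_lev v) v j) - \<phi> (v j)) else 0)"
    unfolding gen_def using qV_sum[of "\<lambda>w. \<phi> (w j) - \<phi> (v j)", OF diff_self] .
  then show ?thesis
    unfolding central
    unfolding up down coordinate_sum[OF j] distrib_right add.assoc .
qed

lemma total_rate: "(\<Sum>w | q v w \<noteq> 0. q v w) \<le> real N * (lam + 1)"
proof -
  have "(\<Sum>w | q v w \<noteq> 0. q v w) = (\<Sum>w | q v w \<noteq> 0. q v w * of_bool (w \<noteq> v))"
    by (intro sum.cong) (auto simp: qV_def)
  also have "\<dots> = (\<Sum>i\<in>{1..m}. lam * real N * (s_of_v v (i - 1) - s_of_v v i) * (if 1 \<le> i then 1 else 0))
    + (\<Sum>i\<in>{1..m}. (1 - p) * real N * (s_of_v v i - s_of_v v (Suc i)) * (if 1 \<le> i then 1 else 0))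
    + (if 0 < v 1 then real N * p else 0)"
    by (subst qV_sum) (simp_all add: vup_neq vdown_neq)
  also have "\<dots> = lam * real N * s_of_v v 0 + (1 - p) * real N * s_of_v v 1 + (if 0 < v 1 then real N * p else 0)"
    by (simp only: coordinate_sum[OF order_refl] diff_self_eq_0 mult_1_right)
  also have "\<dots> \<le> lam * real N * 1 + (1 - p) * real N * 1 + real N * p"
    using lam p s_range[OF v] by (intro add_mono mult_left_mono) auto
  finally show ?thesis by (simp add: algebra_simps)
qed

end

sublocale bounded_rates q st "LamN lam N"
proof
  fix v assume v: "v \<in> st"
  then obtain m where m: "\<forall>i\<ge>m. s_of_v v i = 0" using s_eventually_0[OF v] by blast
  show "0 \<le> q v w" for w by (rule qV_nonneg[OF v m])
  show "q v v = 0" by (simp add: qV_def)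
  show "finite {w. q v w \<noteq> 0}" by (rule finite_qV_support[OF v m])
  show "w \<in> st" if "q v w \<noteq> 0" for w by (rule qV_closed[OF v m that])
  show "(\<Sum>w | q v w \<noteq> 0. q v w) \<le> LamN lam N"
    using total_rate[OF v m] by (simp add: LamN_def)
next
  have "0 \<le> real N * (lam + 1)" using lam by simp
  then show "0 < LamN lam N" by (simp only: LamN_def)
qed

end

section \<open>Positive recurrence\<close>

text \<open>A second-order expansion without derivatives: the arithmetic-geometric mean inequality
  for the two roots bounds the new one, and the root at \<open>x\<close> is at least
  \<open>\<delta>\<close>.\<close>

lemma sqrt_smooth_abs_increment:
  fixes x h \<delta> :: real
  assumes "0 < \<delta>"
  shows "sqrt (\<delta>\<^sup>2 + (x + h)\<^sup>2) \<le> sqrt (\<delta>\<^sup>2 + x\<^sup>2) + h * (x / sqrt (\<delta>\<^sup>2 + x\<^sup>2)) + h\<^sup>2 / (2 * \<delta>)"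
proof -
  define a where "a = sqrt (\<delta>\<^sup>2 + x\<^sup>2)"
  define b where "b = sqrt (\<delta>\<^sup>2 + (x + h)\<^sup>2)"
  have a2: "a\<^sup>2 = \<delta>\<^sup>2 + x\<^sup>2" and b2: "b\<^sup>2 = \<delta>\<^sup>2 + (x + h)\<^sup>2"
    by (simp_all add: a_def b_def)
  have a: "\<delta> \<le> a" unfolding a_def using assms by (intro real_le_rsqrt) simp
  have "2 * (a * b) \<le> a\<^sup>2 + b\<^sup>2" using sum_squares_bound[of a b] by simp
  also have "\<dots> = 2 * a\<^sup>2 + 2 * h * x + h\<^sup>2" unfolding a2 b2 by (simp add: power2_eq_square algebra_simps)
  finally have "b \<le> (2 * a\<^sup>2 + 2 * h * x + h\<^sup>2) / (2 * a)"
    using a assms by (simp add: field_simps)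
  also have "\<dots> = a + h * (x / a) + h\<^sup>2 / (2 * a)"
    using a assms by (simp add: field_simps power2_eq_square)
  also have "h\<^sup>2 / (2 * a) \<le> h\<^sup>2 / (2 * \<delta>)"
    using a assms by (intro divide_left_mono) auto
  finally show ?thesis by (simp add: a_def b_def)
qed

text \<open>After clearing denominators this is Cauchy-Schwarz for the vectors (\<delta>, x) and
  (\<delta>, y). It supplies the convexity used against the drift.\<close>

lemma sqrt_smooth_abs_tangent:
  fixes x y \<delta> :: real
  assumes "0 < \<delta>"
  shows "x / sqrt (\<delta>\<^sup>2 + x\<^sup>2) * (y - x) \<le> sqrt (\<delta>\<^sup>2 + y\<^sup>2) - sqrt (\<delta>\<^sup>2 + x\<^sup>2)"
proof -
  define a where "a = sqrt (\<delta>\<^sup>2 + x\<^sup>2)"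
  define b where "b = sqrt (\<delta>\<^sup>2 + y\<^sup>2)"
  have a2: "a\<^sup>2 = \<delta>\<^sup>2 + x\<^sup>2" and b2: "b\<^sup>2 = \<delta>\<^sup>2 + y\<^sup>2" and nonneg: "0 \<le> a" "0 \<le> b"
    by (simp_all add: a_def b_def)
  have a: "0 < a" unfolding a_def using assms by (simp add: add_pos_nonneg)
  have "(a * b)\<^sup>2 - (\<delta>\<^sup>2 + x * y)\<^sup>2 = \<delta>\<^sup>2 * (x - y)\<^sup>2"
    unfolding power_mult_distrib a2 b2 by algebra
  moreover have "0 \<le> \<delta>\<^sup>2 * (x - y)\<^sup>2" by simp
  ultimately have "(\<delta>\<^sup>2 + x * y)\<^sup>2 \<le> (a * b)\<^sup>2" by linarith
  then have "\<delta>\<^sup>2 + x * y \<le> a * b"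
    by (rule power2_le_imp_le) (intro mult_nonneg_nonneg nonneg)
  then have "x * (y - x) \<le> (b - a) * a"
    using a2 by (simp add: power2_eq_square algebra_simps)
  then show ?thesis
    using a by (simp add: a_def[symmetric] b_def[symmetric] pos_divide_le_eq)
qed

section \<open>A Lyapunov function for the station system\<close>

context system
begin

lemma state_eqI_empty:
  assumes "v \<in> st" "w \<in> st" "v 1 = 0" "w 1 = 0"
  shows "v = w"
proof
  fix i
  have "u i = of_bool (i = 0)" if u: "u \<in> st" "u 1 = 0" for u
    using v_zero[OF u(1)] v_nonneg[OF u(1), of i] v_antimono[OF u(1), of 1 i] u(2) by (cases i) auto
  from this[OF assms(1,3)] this[OF assms(2,4)] show "v i = w i" by simp
qed

lemma gen_coord_id:
  assumes v: "v \<in> st" and j: "1 \<le> j"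
  shows "gen q (\<lambda>v. v j) v
    = lam * s_of_v v (j - 1) - ((1 - p) * s_of_v v j + p * of_bool (0 < s_of_v v j))"
proof -
  obtain m where m: "\<forall>i\<ge>m. s_of_v v i = 0" using s_eventually_0[OF v] by blast
  have "real N * gen q (\<lambda>v. v j) v
      = real N * (lam * s_of_v v (j - 1) - ((1 - p) * s_of_v v j + p * of_bool (0 < s_of_v v j)))"
    unfolding gen_coord[OF v m j, of "\<lambda>x. x"] using N by (simp add: field_simps)
  then show ?thesis using N by simp
qed

text \<open>All jumps from \<open>v\<close> keep the coordinates above \<open>m\<close> at 0, so the
  series is a finite sum on \<open>v\<close> and its neighbours. The central rate \<open>p\<close>
  dominates p s_(i+1), hence each term drifts by at most lam s_i - s_(i+1), and these add up to lam
  v_0 - v_1.\<close>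

lemma gen_total:
  assumes v: "v \<in> st"
  shows "gen q (\<lambda>v. \<Sum>i. v (Suc i)) v \<le> lam - (1 - lam) * v 1"
proof -
  obtain m where m: "\<forall>i\<ge>m. s_of_v v i = 0" using s_eventually_0[OF v] by blast
  have v_0: "v k = 0" if "m \<le> k" for k
    using m that by (intro v_eq_0[OF v]) auto
  have nbr_0: "w k = 0" if w: "w \<in> nbrs m v" and k: "m < k" for w k
  proof -
    have "top_lev v < m" if "0 < v 1"
    proof (rule ccontr)
      assume "\<not> top_lev v < m"
      then have "s_of_v v (top_lev v) = 0" using m by simp
      then show False using top_level(1)[OF v that, of "top_lev v"] by (simp add: top_lev_def)
    qed
    with w k v_0[of k] show ?thesis
      by (auto simp: nbrs_def vup_def vdown_def split: if_splits)
  qed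
  have "gen q (\<lambda>v. \<Sum>i. v (Suc i)) v = gen q (\<lambda>v. \<Sum>i<Suc m. v (Suc i)) v"
  proof (rule gen_cong)
    show "(\<Sum>i. v (Suc i)) = (\<Sum>i<Suc m. v (Suc i))"
      using v_0 by (intro suminf_finite) auto
    show "(\<Sum>i. w (Suc i)) = (\<Sum>i<Suc m. w (Suc i))" if "q v w \<noteq> 0" for w
      using nbr_0[OF qV_support[OF v m that]] by (intro suminf_finite) auto
  qed
  also have "\<dots> = (\<Sum>i<Suc m. gen q (\<lambda>v. v (Suc i)) v)"
    by (rule gen_sum)
  also have "\<dots> \<le> (\<Sum>i<Suc m. lam * s_of_v v i - s_of_v v (Suc i))"
  proof (rule sum_mono)
    fix i
    have "gen q (\<lambda>v. v (Suc i)) v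
        = lam * s_of_v v i - ((1 - p) * s_of_v v (Suc i) + p * of_bool (0 < s_of_v v (Suc i)))"
      using gen_coord_id[OF v, of "Suc i"] by simp
    moreover have "p * s_of_v v (Suc i) \<le> p * of_bool (0 < s_of_v v (Suc i))"
      using s_range[OF v, of "Suc i"] p by (intro mult_left_mono) auto
    ultimately show "gen q (\<lambda>v. v (Suc i)) v \<le> lam * s_of_v v i - s_of_v v (Suc i)"
      by (simp add: algebra_simps)
  qed
  also have "\<dots> = lam * (\<Sum>i<Suc m. s_of_v v i) - (\<Sum>i<Suc m. s_of_v v (Suc i))"
    by (simp only: sum_subtractf sum_distrib_left)
  also have "(\<Sum>i<Suc m. s_of_v v i) = v 0"
    using v_0[of "Suc m"] by (simp only: s_of_v_def sum_lessThan_telescope')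
  also have "(\<Sum>i<Suc m. s_of_v v (Suc i)) = v 1"
    unfolding s_of_v_def sum_lessThan_telescope'[of "\<lambda>i. v (Suc i)"] using v_0[of "Suc (Suc m)"] by simp
  finally show ?thesis
    using v_zero[OF v] by (simp add: algebra_simps)
qed

lemma departure_rate_ge:
  assumes v: "v \<in> st" and "0 < v 1"
  shows "1 \<le> (1 - p) * real N * s_of_v v 1 + real N * p * of_bool (0 < s_of_v v 1)"
proof -
  have pos: "0 < s_of_v v 1" using assms v_pos_iff[OF v] by blast
  have "(1 - p) * 1 \<le> (1 - p) * (real N * s_of_v v 1)"
    using s_pos_ge[OF v pos] p by (intro mult_left_mono) auto
  moreover have "1 * p \<le> real N * p" using N p by (intro mult_right_mono) auto
  ultimately show ?thesis using pos by (simp add: algebra_simps)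
qed

text \<open>\<open>N * v 1\<close> is the number of tasks. A departure multiplies the power by 2 N,
  while its rate is at least 1 and arrivals have rate at most N. The base 1 / (2 N) is small enough
  for departures to prevail even with a single busy station.\<close>

lemma gen_powr:
  assumes v: "v \<in> st" and pos: "0 < v 1" and c: "0 \<le> c"
  defines "r \<equiv> 1 / (2 * real N)"
  shows "gen q (\<lambda>v. c * (1 - r powr (real N * v 1))) v \<le> - (c * r powr (real N * v 1) / 2)"
proof -
  obtain m where m: "\<forall>i\<ge>m. s_of_v v i = 0" using s_eventually_0[OF v] by blast
  define R where "R = r powr (real N * v 1)"
  define D where "D = (1 - p) * real N * s_of_v v 1 + real N * p * of_bool (0 < s_of_v v 1)"
  have r: "0 < r" "r \<le> 1 / 2" using N by (simp_all add: r_def field_simps)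
  have R: "0 < R" using r by (simp add: R_def)
  have up: "r powr (real N * (v 1 + 1 / real N)) = R * r"
    using N r by (simp add: R_def distrib_left powr_add)
  have down: "r powr (real N * (v 1 - 1 / real N)) = R / r"
    using N r by (simp add: R_def right_diff_distrib powr_diff)
  have "gen q (\<lambda>v. c * (1 - r powr (real N * v 1))) v
      = lam * real N * s_of_v v (1 - 1) * (c * (1 - R * r) - c * (1 - R)) + D * (c * (1 - R / r) - c * (1 - R))"
    unfolding up[symmetric] down[symmetric] D_def unfolding R_def
    by (rule gen_coord[OF v m order_refl, of "\<lambda>x. c * (1 - r powr (real N * x))"])
  also have "\<dots> = lam * real N * (c * (R - R * r)) + D * (c * (R - R / r))"
    using s_zero[OF v] by (simp add: right_diff_distrib)
  also have "\<dots> = c * R * (1 - r) * (lam * real N - D / r)"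
    using r by (simp add: field_simps)
  also have "\<dots> \<le> c * R * (1 - r) * (- (1 / (2 * r)))"
  proof (rule mult_left_mono)
    have "lam * real N \<le> 1 * real N" using lam by (intro mult_right_mono) auto
    moreover have "1 * (2 * real N) \<le> D * (2 * real N)"
      using departure_rate_ge[OF v pos] unfolding D_def by (rule mult_right_mono) simp
    ultimately show "lam * real N - D / r \<le> - (1 / (2 * r))"
      by (simp add: r_def)
    show "0 \<le> c * R * (1 - r)" using c R r by simp
  qed
  also have "\<dots> = - (c * R) * ((1 - r) / (2 * r))" by simp
  also have "\<dots> \<le> - (c * R) * (1 / 2)"
    using c R r by (intro mult_left_mono_neg) (auto simp: field_simps)
  finally show ?thesis by (simp add: R_def)
qed

text \<open>The quadratic total \<open>\<Sum>i. v (Suc i)\<close> drifts down only far from the empty state. The bounded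
  term, concave in the number of tasks, makes the drift negative at the remaining nonempty states.\<close>
lemma positive_recurrent:
  shows "ctmc_pos_recurrent (LamN lam N) q st" and "\<exists>!\<pi>. ctmc_stationary q st \<pi>"
proof -
  define e where "e = V_of N (\<lambda>_. 0)"
  have e: "e \<in> st" "e 1 = 0" by (auto simp: e_def XV_def V_of_eq)
  define r where "r = 1 / (2 * real N)"
  \<comment> \<open>Above \<open>B\<close> the total alone drifts by at most lam - 2 < -1. Up to
    \<open>B\<close> the factor 4 makes the bounded term contribute at most -2, against at most lam
    from the total.\<close>
  define B where "B = 2 / (1 - lam)"
  define c where "c = 4 / r powr (real N * B)"
  have r: "0 < r" "r \<le> 1" using N by (simp_all add: r_def field_simps)
  have c: "0 < c" using r by (simp add: c_def)
  define h where "h v = (\<Sum>i. v (Suc i)) + c * (1 - r powr (real N * v 1))" for v :: "nat \<Rightarrow> real"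
  have h_nonneg: "0 \<le> h v" if v: "v \<in> st" for v
  proof -
    obtain m where m: "\<forall>i\<ge>m. s_of_v v i = 0" using s_eventually_0[OF v] by blast
    have "v (Suc i) = 0" if "i \<notin> {..<m}" for i
      using m that by (intro v_eq_0[OF v]) auto
    then have "(\<Sum>i. v (Suc i)) = (\<Sum>i<m. v (Suc i))"
      by (intro suminf_finite) auto
    also have "\<dots> \<ge> 0" using v_nonneg[OF v] by (intro sum_nonneg)
    finally have "0 \<le> (\<Sum>i. v (Suc i))" .
    moreover have "r powr (real N * v 1) \<le> r powr 0"
      using r v_nonneg[OF v, of 1] by (intro powr_mono') auto
    ultimately show ?thesis using r c by (simp add: h_def)
  qed
  have drift: "gen q h v \<le> - 1" if v: "v \<in> st" and "v \<noteq> e" for v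
  proof -
    have pos: "0 < v 1"
      using state_eqI_empty[OF v e(1) _ e(2)] \<open>v \<noteq> e\<close> v_nonneg[OF v, of 1] by fastforce
    define R where "R = r powr (real N * v 1)"
    have "gen q h v = gen q (\<lambda>v. \<Sum>i. v (Suc i)) v + gen q (\<lambda>v. c * (1 - r powr (real N * v 1))) v"
      unfolding h_def by (rule gen_add)
    also have "\<dots> \<le> lam - (1 - lam) * v 1 - c * R / 2"
      using gen_total[OF v] gen_powr[OF v pos less_imp_le[OF c]] by (simp add: r_def R_def)
    also have "\<dots> \<le> - 1"
    proof (cases "v 1 \<le> B")
      case True
      have "r powr (real N * B) \<le> R"
        unfolding R_def using r True by (intro powr_mono' mult_left_mono) auto
      then have "c * (r powr (real N * B)) \<le> c * R" using c by (intro mult_left_mono) auto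
      then have "4 \<le> c * R" using r by (simp add: c_def)
      moreover have "0 \<le> (1 - lam) * v 1" using lam pos by simp
      ultimately show ?thesis using lam by simp
    next
      case False
      then have "(1 - lam) * B \<le> (1 - lam) * v 1" using lam by (intro mult_left_mono) auto
      moreover have "(1 - lam) * B = 2" using lam by (simp add: B_def field_simps)
      ultimately have "2 \<le> (1 - lam) * v 1" by simp
      moreover have "0 \<le> c * R / 2" using c r by (simp add: R_def)
      ultimately show ?thesis using lam by simp
    qed
    finally show ?thesis .
  qed
  show "ctmc_pos_recurrent (LamN lam N) q st" and "\<exists>!\<pi>. ctmc_stationary q st \<pi>"
    by (rule foster[OF e(1) h_nonneg zero_less_one drift]; assumption)+
qed

end

section \<open>Moments under a stationary law\<close>

context system
begin

lemma departure_rate_bounds: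
  assumes v: "v \<in> st"
  defines "D j \<equiv> (1 - p) * real N * s_of_v v j + real N * p * of_bool (0 < s_of_v v j)"
  shows "real N * s_of_v v j \<le> D j" and "D j \<le> real N"
proof -
  have "real N * p * s_of_v v j \<le> real N * p * of_bool (0 < s_of_v v j)"
    using s_range[OF v, of j] p by (intro mult_left_mono) auto
  then show "real N * s_of_v v j \<le> D j" by (simp add: D_def algebra_simps)
  have "(1 - p) * real N * s_of_v v j \<le> (1 - p) * real N * 1"
    using s_range[OF v, of j] p by (intro mult_left_mono) auto
  moreover have "real N * p * of_bool (0 < s_of_v v j) \<le> real N * p * 1"
    using p by (intro mult_left_mono) auto
  ultimately show "D j \<le> real N" by (simp add: D_def algebra_simps)
qed

text \<open>Truncation makes the function bounded, so stationarity applies before any moment is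
  known. An arrival raises it by at most 1 / N; a departure is credited only for
  \<open>v j \<le> M\<close>, where it lowers the minimum by a full step.\<close>

lemma gen_min:
  assumes v: "v \<in> st" and j: "1 \<le> j"
  shows "gen q (\<lambda>v. min (v j) M) v \<le> lam * s_of_v v (j - 1) - s_of_v v j * of_bool (v j \<le> M)"
proof -
  obtain m where m: "\<forall>i\<ge>m. s_of_v v i = 0" using s_eventually_0[OF v] by blast
  define U where "U = lam * real N * s_of_v v (j - 1)"
  define D where "D = (1 - p) * real N * s_of_v v j + real N * p * of_bool (0 < s_of_v v j)"
  have N_pos: "0 < real N" using N by simp
  have h_pos: "0 < 1 / real N" using N_pos by simp
  have U: "0 \<le> U" using lam s_range[OF v] by (simp add: U_def)
  have s_D: "real N * s_of_v v j \<le> D" using departure_rate_bounds(1)[OF v] by (simp add: D_def)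
  have D: "0 \<le> D" using order_trans[OF _ s_D] s_range[OF v] by simp
  have "gen q (\<lambda>v. min (v j) M) v
      = U * (min (v j + 1 / real N) M - min (v j) M) + D * (min (v j - 1 / real N) M - min (v j) M)"
    unfolding U_def D_def by (rule gen_coord[OF v m j, of "\<lambda>x. min x M"])
  also have "U * (min (v j + 1 / real N) M - min (v j) M) \<le> U * (1 / real N)"
    by (rule mult_left_mono[OF _ U]) (use h_pos in linarith)
  also have "U * (1 / real N) = lam * s_of_v v (j - 1)"
    using N_pos by (simp add: U_def)
  also have "D * (min (v j - 1 / real N) M - min (v j) M) \<le> - (s_of_v v j * of_bool (v j \<le> M))"
  proof (cases "v j \<le> M")
    case True
    then have "min (v j - 1 / real N) M - min (v j) M = - (1 / real N)"
      using h_pos by linarith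
    then show ?thesis using True s_D N_pos by (simp add: pos_le_divide_eq mult.commute)
  next
    case False
    then have "min (v j - 1 / real N) M - min (v j) M \<le> 0" by simp
    then show ?thesis using D False by (simp add: mult_nonneg_nonpos)
  qed
  finally show ?thesis by simp
qed

text \<open>For \<open>p = 1\<close> the coordinate \<open>v 1\<close> is a walk with rates lam N up
  and N down. Squaring turns its constant negative drift into one proportional to
  \<open>v 1\<close>, and the second-order terms amount to at most 2 / N.\<close>

lemma gen_min_square:
  assumes v: "v \<in> st" and "p = 1" and M: "0 \<le> M"
  shows "gen q (\<lambda>v. (min (v 1) M)\<^sup>2) v \<le> 2 / real N - 2 * (1 - lam) * (v 1 * of_bool (v 1 \<le> M))"
proof -
  obtain m where m: "\<forall>i\<ge>m. s_of_v v i = 0" using s_eventually_0[OF v] by blast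
  define x h where "x = v 1" and "h = 1 / real N"
  have h: "0 < h" "real N * h = 1" using N by (simp_all add: h_def)
  have x: "0 \<le> x" using v_nonneg[OF v] by (simp add: x_def)
  \<comment> \<open>A nonempty system holds at least one task. This keeps \<open>x - h\<close>
    nonnegative, so that squaring preserves the order.\<close>
  have x_ge: "h \<le> x" if "0 < x"
  proof -
    have "0 < s_of_v v 1" using that v_pos_iff[OF v] by (simp add: x_def)
    then have "1 \<le> real N * s_of_v v 1" by (rule s_pos_ge[OF v])
    also have "\<dots> \<le> real N * x" using s_le_v[OF v] by (simp add: x_def mult_left_mono)
    finally show ?thesis using N by (simp add: h_def field_simps)
  qed
  have "gen q (\<lambda>v. (min (v 1) M)\<^sup>2) v
      = lam * real N * s_of_v v (1 - 1) * ((min (x + h) M)\<^sup>2 - (min x M)\<^sup>2)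
        + ((1 - p) * real N * s_of_v v 1 + real N * p * of_bool (0 < s_of_v v 1)) * ((min (x - h) M)\<^sup>2 - (min x M)\<^sup>2)"
    unfolding x_def h_def by (rule gen_coord[OF v m order_refl, of "\<lambda>x. (min x M)\<^sup>2"])
  also have "\<dots> = lam * real N * ((min (x + h) M)\<^sup>2 - (min x M)\<^sup>2)
        + real N * (of_bool (0 < x) * ((min (x - h) M)\<^sup>2 - (min x M)\<^sup>2))"
    using \<open>p = 1\<close> s_zero[OF v] v_pos_iff[OF v, of 1] by (simp add: x_def)
  also have "\<dots> \<le> 2 * h - 2 * (1 - lam) * (x * of_bool (x \<le> M))"
  proof (cases "x \<le> M")
    case True
    have "(min (x + h) M)\<^sup>2 \<le> (x + h)\<^sup>2"
      using x M h by (intro power_mono) auto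
    then have "(min (x + h) M)\<^sup>2 - (min x M)\<^sup>2 \<le> 2 * (x * h) + h * h"
      using True by (simp add: power2_eq_square algebra_simps)
    then have "lam * real N * ((min (x + h) M)\<^sup>2 - (min x M)\<^sup>2) \<le> lam * real N * (2 * (x * h) + h * h)"
      using lam by (intro mult_left_mono) auto
    also have "\<dots> = lam * (2 * x * (real N * h) + h * (real N * h))" by (simp add: algebra_simps)
    also have "\<dots> = lam * (2 * x + h)" unfolding h(2) by simp
    finally have up: "lam * real N * ((min (x + h) M)\<^sup>2 - (min x M)\<^sup>2) \<le> lam * (2 * x + h)" .
    have down: "real N * (of_bool (0 < x) * ((min (x - h) M)\<^sup>2 - (min x M)\<^sup>2)) \<le> h - 2 * x"
    proof (cases "0 < x")
      case pos: True
      have "min (x - h) M = x - h" "min x M = x" using True h by auto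
      then have "real N * (of_bool (0 < x) * ((min (x - h) M)\<^sup>2 - (min x M)\<^sup>2)) = real N * (h * h - 2 * x * h)"
        using pos by (simp add: power2_eq_square algebra_simps)
      also have "\<dots> = h * (real N * h) - 2 * x * (real N * h)" by (simp add: algebra_simps)
      finally show ?thesis unfolding h(2) by simp
    qed (use x h in simp)
    have "lam * h \<le> 1 * h" using lam h by (intro mult_right_mono) auto
    then show ?thesis using up down True by (simp add: algebra_simps)
  next
    case False
    then have "0 < x" and up: "min (x + h) M = M" and cur: "min x M = M" using M h by auto
    then have "(min (x - h) M)\<^sup>2 \<le> M\<^sup>2"
      using x_ge M by (intro power_mono) auto
    then have "real N * ((min (x - h) M)\<^sup>2 - M\<^sup>2) \<le> 0"
      by (simp add: mult_nonneg_nonpos)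
    then show ?thesis using False \<open>0 < x\<close> h by (simp add: up cur)
  qed
  finally show ?thesis by (simp add: x_def h_def)
qed

end

locale stationary_system = system +
  fixes \<pi> :: "(nat \<Rightarrow> real) pmf"
  assumes stat: "ctmc_stationary (qV lam p N) (XV N) \<pi>"
begin

abbreviation Ex :: "((nat \<Rightarrow> real) \<Rightarrow> real) \<Rightarrow> real" where
  "Ex \<equiv> measure_pmf.expectation \<pi>"

lemma AE_st: "AE v in \<pi>. v \<in> st"
  using stat by (auto simp: ctmc_stationary_def AE_measure_pmf_iff)

lemma integrable_bounded:
  assumes "\<And>v. v \<in> st \<Longrightarrow> \<bar>f v\<bar> \<le> B"
  shows "integrable (measure_pmf \<pi>) (f :: (nat \<Rightarrow> real) \<Rightarrow> real)"
  using AE_st assms by (intro measure_pmf.integrable_const_bound[where B=B]) (auto elim: eventually_mono)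

lemma Ex_mono:
  assumes "integrable (measure_pmf \<pi>) f" "integrable (measure_pmf \<pi>) g" "\<And>v. v \<in> st \<Longrightarrow> f v \<le> g v"
  shows "Ex f \<le> Ex g"
  using assms AE_st by (intro integral_mono_AE) (auto elim: eventually_mono)

lemma Ex_gen:
  assumes "\<forall>v\<in>st. 0 \<le> F v" and "integrable (measure_pmf \<pi>) F"
  shows "integrable (measure_pmf \<pi>) (gen q F)" and "Ex (gen q F) = 0"
  using stationary_gen[OF stat, of F] assms by blast+

lemma integrable_s: "integrable (measure_pmf \<pi>) (\<lambda>v. s_of_v v j)"
  using s_range by (intro integrable_bounded[where B=1]) auto

lemma Ex_truncation_tendsto:
  assumes "integrable (measure_pmf \<pi>) f"
  shows "(\<lambda>n. Ex (\<lambda>v. f v * of_bool (v j \<le> real n))) \<longlonglongrightarrow> Ex f"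
proof (rule integral_dominated_convergence[where w="\<lambda>v. \<bar>f v\<bar>"])
  show "AE v in \<pi>. (\<lambda>n. f v * of_bool (v j \<le> real n)) \<longlonglongrightarrow> f v"
  proof (rule AE_I2)
    fix v :: "nat \<Rightarrow> real"
    obtain n0 where n0: "v j \<le> real n0" using real_arch_simple by blast
    have "eventually (\<lambda>n. f v = f v * of_bool (v j \<le> real n)) sequentially"
      using eventually_ge_at_top[of n0] by eventually_elim (use n0 in auto)
    then show "(\<lambda>n. f v * of_bool (v j \<le> real n)) \<longlonglongrightarrow> f v"
      by (rule Lim_transform_eventually[OF tendsto_const])
  qed
qed (use assms in auto)

text \<open>Flow balance for coordinate j + 1: per station the inflow is lam s_j, and local and
  central departures together remove at least s_(j+1). The truncation is lifted by dominated
  convergence, since the levels are bounded.\<close>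

lemma Ex_s_Suc_le: "Ex (\<lambda>v. s_of_v v (Suc j)) \<le> lam * Ex (\<lambda>v. s_of_v v j)"
proof (rule LIMSEQ_le_const2[OF Ex_truncation_tendsto[OF integrable_s, where j="Suc j"]])
  have "Ex (\<lambda>v. s_of_v v (Suc j) * of_bool (v (Suc j) \<le> real n)) \<le> lam * Ex (\<lambda>v. s_of_v v j)" for n
  proof -
    have int: "integrable (measure_pmf \<pi>) (\<lambda>v. s_of_v v (Suc j) * of_bool (v (Suc j) \<le> real n))"
      using s_range by (intro integrable_bounded[where B=1]) auto
    have nonneg: "\<forall>v\<in>st. 0 \<le> min (v (Suc j)) (real n)"
      using v_nonneg by simp
    have "integrable (measure_pmf \<pi>) (\<lambda>v. min (v (Suc j)) (real n))"
      using nonneg by (intro integrable_bounded[where B="real n"]) auto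
    note gen = Ex_gen[OF nonneg this]
    have "0 \<le> Ex (\<lambda>v. lam * s_of_v v j - s_of_v v (Suc j) * of_bool (v (Suc j) \<le> real n))"
      unfolding gen(2)[symmetric]
      using gen_min[of _ "Suc j" "real n"] int integrable_s gen(1) by (intro Ex_mono) auto
    also have "\<dots> = lam * Ex (\<lambda>v. s_of_v v j) - Ex (\<lambda>v. s_of_v v (Suc j) * of_bool (v (Suc j) \<le> real n))"
      using int integrable_s by simp
    finally show ?thesis by simp
  qed
  then show "\<exists>n0. \<forall>n\<ge>n0. Ex (\<lambda>v. s_of_v v (Suc j) * of_bool (v (Suc j) \<le> real n)) \<le> lam * Ex (\<lambda>v. s_of_v v j)"
    by blast
qed

lemma Ex_s_le: "Ex (\<lambda>v. s_of_v v j) \<le> lam ^ j"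
proof (induction j)
  case 0
  have "Ex (\<lambda>v. s_of_v v 0) = Ex (\<lambda>_. 1)"
    using AE_st s_zero by (intro integral_cong_AE) (auto elim: eventually_mono)
  then show ?case by simp
next
  case (Suc j)
  then show ?case
    using Ex_s_Suc_le[of j] mult_left_mono[OF Suc.IH lam(1)] by simp
qed

text \<open>\<open>v j\<close> is a tail sum of levels, so the geometric decay of their means gives
  integrability and bound together. This admits functions of linear growth in
  \<open>Ex_gen\<close>.\<close>

lemma v_moment: "integrable (measure_pmf \<pi>) (\<lambda>v. v j)" "Ex (\<lambda>v. v j) \<le> lam ^ j / (1 - lam)"
proof -
  have nonneg: "AE v in \<pi>. 0 \<le> v j"
    using AE_st v_nonneg by (auto elim: eventually_mono)
  have geo: "(\<lambda>i. lam ^ (j + i)) sums (lam ^ j / (1 - lam))"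
    using sums_mult[OF geometric_sums, of lam "lam ^ j"] lam by (simp add: power_add)
  have "(\<integral>\<^sup>+v. ennreal (v j) \<partial>\<pi>) = (\<integral>\<^sup>+v. (\<Sum>i. ennreal (s_of_v v (j + i))) \<partial>\<pi>)"
  proof (rule nn_integral_cong_AE, use AE_st in eventually_elim)
    case (elim v)
    then show ?case
      using suminf_ennreal_eq[OF s_range(1)[OF elim] s_sums[OF elim]] by simp
  qed
  also have "\<dots> = (\<Sum>i. \<integral>\<^sup>+v. ennreal (s_of_v v (j + i)) \<partial>\<pi>)"
    by (intro nn_integral_suminf) simp
  also have "\<dots> = (\<Sum>i. ennreal (Ex (\<lambda>v. s_of_v v (j + i))))"
    using AE_st s_range by (intro suminf_cong nn_integral_eq_integral integrable_s) (auto elim: eventually_mono)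
  also have "\<dots> \<le> (\<Sum>i. ennreal (lam ^ (j + i)))"
    using Ex_s_le by (intro suminf_le ennreal_leI) auto
  also have "\<dots> = ennreal (lam ^ j / (1 - lam))"
    using lam by (intro suminf_ennreal_eq geo) simp
  finally have le: "(\<integral>\<^sup>+v. ennreal (v j) \<partial>\<pi>) \<le> ennreal (lam ^ j / (1 - lam))" .
  then show int: "integrable (measure_pmf \<pi>) (\<lambda>v. v j)"
    using nonneg by (intro integrableI_nonneg) (auto intro: le_less_trans)
  have "ennreal (Ex (\<lambda>v. v j)) \<le> ennreal (lam ^ j / (1 - lam))"
    using le nn_integral_eq_integral[OF int nonneg] by simp
  then show "Ex (\<lambda>v. v j) \<le> lam ^ j / (1 - lam)"
    using lam by (simp add: ennreal_le_iff)
qed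

lemma Ex_v_1_le:
  assumes "p = 1"
  shows "Ex (\<lambda>v. v 1) \<le> 1 / ((1 - lam) * real N)"
proof (rule LIMSEQ_le_const2[OF Ex_truncation_tendsto[OF v_moment(1), where j=1]])
  have "Ex (\<lambda>v. v 1 * of_bool (v 1 \<le> real n)) \<le> 1 / ((1 - lam) * real N)" for n
  proof -
    have int: "integrable (measure_pmf \<pi>) (\<lambda>v. v 1 * of_bool (v 1 \<le> real n))"
      using v_nonneg by (intro integrable_bounded[where B="real n"]) auto
    have nonneg: "\<forall>v\<in>st. 0 \<le> (min (v 1) (real n))\<^sup>2" by simp
    have "integrable (measure_pmf \<pi>) (\<lambda>v. (min (v 1) (real n))\<^sup>2)"
      using v_nonneg by (intro integrable_bounded[where B="(real n)\<^sup>2"]) (auto intro!: power_mono)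
    note gen = Ex_gen[OF nonneg this]
    have "0 \<le> Ex (\<lambda>v. 2 / real N - 2 * (1 - lam) * (v 1 * of_bool (v 1 \<le> real n)))"
      unfolding gen(2)[symmetric]
      using gen_min_square[OF _ assms, of _ "real n"] int gen(1) by (intro Ex_mono) auto
    also have "\<dots> = 2 / real N - 2 * (1 - lam) * Ex (\<lambda>v. v 1 * of_bool (v 1 \<le> real n))"
      using int by simp
    finally show ?thesis using lam N by (simp add: field_simps)
  qed
  then show "\<exists>n0. \<forall>n\<ge>n0. Ex (\<lambda>v. v 1 * of_bool (v 1 \<le> real n)) \<le> 1 / ((1 - lam) * real N)"
    by blast
qed

end

section \<open>Distance to an equilibrium\<close>

lemma VbarE:
  assumes "a \<in> Vbar"
  obtains s where "s \<in> Sbar" "\<forall>i. (\<lambda>j. s (i + j)) sums a i" "s_of_v a = s"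
proof -
  obtain s where s: "s \<in> Sbar" and a: "\<And>i. a i = (\<Sum>j. s (i + j))"
    using assms by (auto simp: Vbar_def)
  have "summable s" using s by (simp add: Sbar_def summable_Suc_iff)
  then have "summable (\<lambda>j. s (i + j))" for i
    by (subst add.commute) (rule summable_ignore_initial_segment)
  then have sums: "(\<lambda>j. s (i + j)) sums a i" for i
    unfolding a by (rule summable_sums)
  have "s_of_v a = s"
  proof
    fix i
    have "(\<lambda>j. s (i + Suc j)) sums (a i - s (i + 0))"
      using sums[of i] by (subst sums_Suc_iff) simp
    then show "s_of_v a i = s i"
      using sums_unique2[OF _ sums[of "Suc i"]] by (simp add: s_of_v_def)
  qed
  with s sums show ?thesis using that by blast
qed

lemma Vbar_s:
  assumes "a \<in> Vbar"
  shows "s_of_v a 0 = 1" "0 \<le> s_of_v a i" "s_of_v a i \<le> 1" "s_of_v a (Suc i) \<le> s_of_v a i"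
proof -
  obtain s where "s \<in> Sbar" "s_of_v a = s"
    using VbarE[OF assms] by metis
  then show "s_of_v a 0 = 1" "0 \<le> s_of_v a i" "s_of_v a i \<le> 1" "s_of_v a (Suc i) \<le> s_of_v a i"
    by (auto simp: Sbar_def)
qed

lemma Vbar_nonneg:
  assumes "a \<in> Vbar"
  shows "0 \<le> a i"
proof -
  obtain s where s: "s \<in> Sbar" "\<forall>i. (\<lambda>j. s (i + j)) sums a i" "s_of_v a = s"
    by (rule VbarE[OF assms])
  show ?thesis
    by (rule sums_le[OF _ sums_zero s(2)[rule_format]]) (use s(1) in \<open>simp add: Sbar_def\<close>)
qed

lemma Vbar_zero: "a \<in> Vbar \<Longrightarrow> a 0 = 1 + a 1"
  using Vbar_s(1)[of a] by (simp add: s_of_v_def)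

lemma Vbar_antimono:
  assumes "a \<in> Vbar" "i \<le> j"
  shows "a j \<le> a i"
proof (rule lift_Suc_antimono_le[of a, OF _ assms(2)])
  show "a (Suc n) \<le> a n" for n
    using Vbar_s(2)[OF assms(1), of n] by (simp add: s_of_v_def)
qed

lemma Vbar_tendsto_0:
  assumes "a \<in> Vbar"
  shows "a \<longlonglongrightarrow> 0"
proof -
  obtain s where s: "s \<in> Sbar" "\<forall>i. (\<lambda>j. s (i + j)) sums a i" "s_of_v a = s"
    by (rule VbarE[OF assms])
  have "(\<Sum>j<i. s j) = a 0 - a i" for i
    unfolding s(3)[symmetric] s_of_v_def by (rule sum_lessThan_telescope')
  moreover have "(\<lambda>i. \<Sum>j<i. s j) \<longlonglongrightarrow> a 0"
    using s(2)[rule_format, of 0] by (simp add: sums_def)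
  ultimately have "(\<lambda>i. a 0 - (a 0 - a i)) \<longlonglongrightarrow> a 0 - a 0"
    by (intro tendsto_diff tendsto_const) simp
  then show ?thesis by simp
qed

lemma XV_subset_Vbar:
  assumes "1 \<le> N"
  shows "XV N \<subseteq> Vbar"
proof
  fix v assume "v \<in> XV N"
  then obtain Q where v: "v = V_of N Q" by (auto simp: XV_def)
  \<comment> \<open>The facts on states do not involve the rates, so any admissible parameters
    serve.\<close>
  interpret system 0 0 N using assms by unfold_locales auto
  have in_st: "v \<in> st" by fact
  have "summable (S_of N Q)" using S_of_sums[of N Q 0] by (simp add: sums_iff)
  then have "S_of N Q \<in> Sbar"
    using s_zero[OF in_st] s_range[OF in_st] s_antimono[OF in_st]
    by (auto simp: Sbar_def v s_of_V_of summable_Suc_iff)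
  then show "v \<in> Vbar" unfolding Vbar_def v V_of_def by blast
qed

text \<open>Constants c_j with x_j - x_(j+1) \<le> c_j / (\<delta> N) for the mean smoothed
  distances x_j. The start 0 encodes \<open>d 0 = d 1\<close>; the recursion is the balance
  inequality divided by \<open>1 - p\<close>.\<close>

primrec drift_const :: "real \<Rightarrow> real \<Rightarrow> nat \<Rightarrow> real" where
  "drift_const lam p 0 = 0"
| "drift_const lam p (Suc j) = (1 + lam * drift_const lam p j) / (1 - p)"

locale target_system = stationary_system +
  fixes a :: "nat \<Rightarrow> real"
  assumes a_in: "a \<in> Vbar" and a_eqs: "vI_eqs lam p a"
begin

definition d :: "nat \<Rightarrow> (nat \<Rightarrow> real) \<Rightarrow> real" where "d j v = v j - a j"

lemma d_zero: "v \<in> st \<Longrightarrow> d 0 v = d 1 v"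
  using v_zero[of v] Vbar_zero[OF a_in] by (simp add: d_def)

lemma integrable_d: "integrable (measure_pmf \<pi>) (d j)"
  unfolding d_def using v_moment(1) by simp

context
  fixes \<delta> :: real assumes \<delta>: "0 < \<delta>"
begin

definition sm :: "real \<Rightarrow> real" where "sm x = sqrt (\<delta>\<^sup>2 + x\<^sup>2)"

lemma sm_bounds: "\<bar>x\<bar> \<le> sm x" "sm x \<le> \<delta> + \<bar>x\<bar>" "0 < sm x"
proof -
  show "\<bar>x\<bar> \<le> sm x" unfolding sm_def by (rule real_le_rsqrt) simp
  show "sm x \<le> \<delta> + \<bar>x\<bar>"
    unfolding sm_def using \<delta> by (intro real_le_lsqrt) (auto simp: power2_sum)
  show "0 < sm x" unfolding sm_def using \<delta> by (simp add: add_pos_nonneg)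
qed

lemma integrable_sm: "integrable (measure_pmf \<pi>) (\<lambda>v. sm (d j v))"
proof (rule Bochner_Integration.integrable_bound)
  show "integrable (measure_pmf \<pi>) (\<lambda>v. \<delta> + \<bar>d j v\<bar>)"
    using integrable_d by simp
  show "AE v in \<pi>. norm (sm (d j v)) \<le> norm (\<delta> + \<bar>d j v\<bar>)"
    using sm_bounds(2,3) \<delta> by (intro AE_I2) (simp add: abs_of_pos abs_of_nonneg)
qed simp

text \<open>The slope \<open>u\<close> multiplies the drift of \<open>v j\<close> less the drift of
  \<open>a\<close>, which is 0, and convexity turns slope times increment into increments of
  \<open>sm\<close>. Both jump rates are at most N and each jump leaves a remainder
  \<open>h\<^sup>2 / (2 * \<delta>)\<close>, in total 1 / (\<delta> N).\<close>

lemma gen_sm: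
  assumes v: "v \<in> st" and j: "1 \<le> j"
  shows "gen q (\<lambda>v. sm (d j v)) v \<le> lam * (sm (d (j - 1) v) - sm (d j v))
    + (1 - p) * (sm (d (Suc j) v) - sm (d j v)) + 1 / (\<delta> * real N)"
proof -
  obtain m where m: "\<forall>i\<ge>m. s_of_v v i = 0" using s_eventually_0[OF v] by blast
  define U where "U = lam * real N * s_of_v v (j - 1)"
  define b where "b = (of_bool (0 < s_of_v v j) :: real)"
  define D where "D = (1 - p) * real N * s_of_v v j + real N * p * b"
  define h where "h = 1 / real N"
  define u where "u = d j v / sm (d j v)"
  have h: "0 < h" "real N * h = 1" using N by (simp_all add: h_def)
  have "lam * real N * s_of_v v (j - 1) \<le> 1 * real N * 1"
    using lam s_range[OF v] by (intro mult_mono) auto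
  then have U: "0 \<le> U" "U \<le> real N" using lam s_range[OF v] by (simp_all add: U_def)
  have D_ge: "real N * s_of_v v j \<le> D" and D_le: "D \<le> real N"
    using departure_rate_bounds[OF v] by (simp_all add: D_def b_def)
  have D: "0 \<le> D" by (rule order_trans[OF _ D_ge]) (simp add: s_range[OF v])
  define \<eta> where "\<eta> = h\<^sup>2 / (2 * \<delta>)"
  have up: "sm (d j v + h) - sm (d j v) \<le> h * u + \<eta>"
    using sqrt_smooth_abs_increment[OF \<delta>, of "d j v" h] by (simp add: sm_def u_def \<eta>_def)
  have down: "sm (d j v - h) - sm (d j v) \<le> - h * u + \<eta>"
    using sqrt_smooth_abs_increment[OF \<delta>, of "d j v" "- h"] by (simp add: sm_def u_def \<eta>_def)
  have tangent: "u * (y - d j v) \<le> sm y - sm (d j v)" for y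
    unfolding u_def sm_def by (rule sqrt_smooth_abs_tangent[OF \<delta>])
  have "gen q (\<lambda>v. sm (d j v)) v = U * (sm (v j + h - a j) - sm (v j - a j)) + D * (sm (v j - h - a j) - sm (v j - a j))"
    unfolding U_def D_def b_def h_def d_def by (rule gen_coord[OF v m j, of "\<lambda>x. sm (x - a j)"])
  also have "\<dots> = U * (sm (d j v + h) - sm (d j v)) + D * (sm (d j v - h) - sm (d j v))"
    by (simp add: d_def algebra_simps)
  also have "\<dots> \<le> U * (h * u + \<eta>) + D * (- h * u + \<eta>)"
    using up down U D by (intro add_mono mult_left_mono)
  also have "\<dots> = u * ((U - D) * h) + (U + D) * (\<eta>)"
    by (simp add: algebra_simps)
  also have "(U - D) * h = (real N * h) * (lam * s_of_v v (j - 1) - (1 - p) * s_of_v v j - p * b)"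
    by (simp add: U_def D_def algebra_simps)
  also have "(U + D) * (\<eta>) \<le> (real N + real N) * (\<eta>)"
    using U D_le \<delta> by (intro mult_right_mono add_mono) (auto simp: \<eta>_def)
  also have "(real N + real N) * (\<eta>) = (real N * h) * h / \<delta>"
    using \<delta> by (simp add: \<eta>_def power2_eq_square field_simps)
  finally have gen_le: "gen q (\<lambda>v. sm (d j v)) v
      \<le> u * (lam * s_of_v v (j - 1) - (1 - p) * s_of_v v j - p * b) + h / \<delta>"
    by (simp add: h(2))
  \<comment> \<open>If \<open>a j > 0\<close>, the equilibrium is served at full rate
    \<open>p\<close>, so the difference is nonzero only at \<open>v j = 0\<close>, where
    \<open>d j\<close> is negative. If \<open>a j = 0\<close>, a positive \<open>v j\<close> is
    served at least as fast, and at \<open>v j = 0\<close> the slope vanishes.\<close>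
  have monotone: "0 \<le> u * (p * b - g_fun lam p a j)"
  proof (cases "0 < a j")
    case True
    show ?thesis
    proof (cases "0 < v j")
      case False
      then have "d j v \<le> 0" using True by (simp add: d_def)
      then have "u \<le> 0" unfolding u_def using sm_bounds(3) by (simp add: divide_nonpos_pos)
      moreover have "p * b - g_fun lam p a j \<le> 0" using True p by (simp add: g_fun_def b_def)
      ultimately show ?thesis by (rule mult_nonpos_nonpos)
    qed (use True in \<open>simp add: g_fun_def b_def v_pos_iff[OF v]\<close>)
  next
    case False
    then have a_j: "a j = 0" using Vbar_nonneg[OF a_in, of j] by simp
    then have d_j: "d j v = v j" by (simp add: d_def)
    show ?thesis
    proof (cases "0 < v j")
      case True
      then have "0 \<le> u" unfolding u_def d_j[symmetric] using sm_bounds(3) by (simp add: divide_nonneg_pos)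
      moreover have "g_fun lam p a j \<le> p" using p by (simp add: g_fun_def)
      then have "0 \<le> p * b - g_fun lam p a j" using True by (simp add: b_def v_pos_iff[OF v])
      ultimately show ?thesis by (rule mult_nonneg_nonneg)
    next
      case False
      then have "u = 0" using v_nonneg[OF v, of j] d_j by (simp add: u_def)
      then show ?thesis by simp
    qed
  qed
  have a_eq: "lam * (a (j - 1) - a j) - (1 - p) * (a j - a (j + 1)) - g_fun lam p a j = 0"
    using a_eqs j by (simp add: vI_eqs_def)
  have s_pred: "s_of_v v (j - 1) = v (j - 1) - v j" using j by (simp add: s_of_v_def)
  have "lam * s_of_v v (j - 1) - (1 - p) * s_of_v v j - p * b
      = lam * (d (j - 1) v - d j v) + (1 - p) * (d (Suc j) v - d j v) - (p * b - g_fun lam p a j)"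
    unfolding s_pred s_of_v_def[of v j] d_def using a_eq by (simp add: algebra_simps)
  then have "u * (lam * s_of_v v (j - 1) - (1 - p) * s_of_v v j - p * b)
      = lam * (u * (d (j - 1) v - d j v)) + (1 - p) * (u * (d (Suc j) v - d j v)) - u * (p * b - g_fun lam p a j)"
    by (simp only:) (simp add: algebra_simps)
  also have "\<dots> \<le> lam * (sm (d (j - 1) v) - sm (d j v)) + (1 - p) * (sm (d (Suc j) v) - sm (d j v))"
    using mult_left_mono[OF tangent lam(1), of "d (j - 1) v"]
      mult_left_mono[OF tangent, of "1 - p" "d (Suc j) v"] p monotone by linarith
  finally show ?thesis using gen_le by (simp add: h_def mult.commute)
qed

lemma Ex_sm_zero: "Ex (\<lambda>v. sm (d 0 v)) = Ex (\<lambda>v. sm (d 1 v))"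
  using AE_st d_zero by (intro integral_cong_AE) (auto elim: eventually_mono)

lemma Ex_sm_balance:
  assumes "1 \<le> j"
  shows "(1 - p) * (Ex (\<lambda>v. sm (d j v)) - Ex (\<lambda>v. sm (d (Suc j) v)))
    \<le> lam * (Ex (\<lambda>v. sm (d (j - 1) v)) - Ex (\<lambda>v. sm (d j v))) + 1 / (\<delta> * real N)"
proof -
  have "\<forall>v\<in>st. 0 \<le> sm (d j v)" using sm_bounds(3) by (simp add: less_imp_le)
  note gen = Ex_gen[OF this integrable_sm]
  have "0 \<le> Ex (\<lambda>v. lam * (sm (d (j - 1) v) - sm (d j v))
      + (1 - p) * (sm (d (Suc j) v) - sm (d j v)) + 1 / (\<delta> * real N))"
    unfolding gen(2)[symmetric] using gen(1) integrable_sm gen_sm[OF _ assms] by (intro Ex_mono) auto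
  also have "\<dots> = lam * (Ex (\<lambda>v. sm (d (j - 1) v)) - Ex (\<lambda>v. sm (d j v)))
      + (1 - p) * (Ex (\<lambda>v. sm (d (Suc j) v)) - Ex (\<lambda>v. sm (d j v))) + 1 / (\<delta> * real N)"
    using integrable_sm by simp
  finally show ?thesis by (simp add: algebra_simps)
qed

text \<open>Levels are climbed from the boundary, each passing on the previous error with factor lam
  / (1 - p). The one-sided bound is the direction required: it estimates a level by a higher
  one.\<close>

lemma Ex_sm_step:
  assumes "p < 1"
  shows "Ex (\<lambda>v. sm (d j v)) - Ex (\<lambda>v. sm (d (Suc j) v)) \<le> drift_const lam p j / (\<delta> * real N)"
proof (induction j)
  case 0
  then show ?case using Ex_sm_zero by simp
next
  case (Suc j)
  have "(1 - p) * (Ex (\<lambda>v. sm (d (Suc j) v)) - Ex (\<lambda>v. sm (d (Suc (Suc j)) v)))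
      \<le> lam * (Ex (\<lambda>v. sm (d j v)) - Ex (\<lambda>v. sm (d (Suc j) v))) + 1 / (\<delta> * real N)"
    using Ex_sm_balance[of "Suc j"] by simp
  also have "\<dots> \<le> lam * (drift_const lam p j / (\<delta> * real N)) + 1 / (\<delta> * real N)"
    using mult_left_mono[OF Suc.IH lam(1)] by simp
  also have "\<dots> = (1 - p) * (drift_const lam p (Suc j) / (\<delta> * real N))"
    using assms by (simp add: add_divide_distrib[symmetric] add.commute)
  finally show ?case
    by (rule mult_left_le_imp_le) (use assms in simp)
qed

lemma Ex_sm_le:
  assumes "p < 1"
  shows "Ex (\<lambda>v. sm (d j v)) \<le> Ex (\<lambda>v. sm (d (j + k) v)) + (\<Sum>i<k. drift_const lam p (j + i)) / (\<delta> * real N)"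
proof (induction k)
  case (Suc k)
  then show ?case
    using Ex_sm_step[OF assms, of "j + k"] by (simp add: add_divide_distrib)
qed simp

text \<open>At level j + k the distance is bounded crudely by v + a, as both have small tails; the
  telescoped errors carry this estimate down to level j.\<close>

lemma Ex_abs_d_le:
  assumes "p < 1"
  shows "Ex (\<lambda>v. \<bar>d j v\<bar>) \<le> lam ^ (j + k) / (1 - lam) + a (j + k) + \<delta>
    + (\<Sum>i<k. drift_const lam p (j + i)) / (\<delta> * real N)"
proof -
  have "Ex (\<lambda>v. \<bar>d j v\<bar>) \<le> Ex (\<lambda>v. sm (d j v))"
    using integrable_d integrable_sm sm_bounds(1) by (intro Ex_mono) auto
  moreover have "Ex (\<lambda>v. sm (d (j + k) v)) \<le> Ex (\<lambda>v. \<delta> + (v (j + k) + a (j + k)))"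
  proof (rule Ex_mono[OF integrable_sm])
    show "sm (d (j + k) v) \<le> \<delta> + (v (j + k) + a (j + k))" if "v \<in> st" for v
      using sm_bounds(2)[of "d (j + k) v"] v_nonneg[OF that, of "j + k"] Vbar_nonneg[OF a_in, of "j + k"]
      unfolding d_def by linarith
  qed (use v_moment(1) in simp)
  moreover have "Ex (\<lambda>v. \<delta> + (v (j + k) + a (j + k))) = \<delta> + (Ex (\<lambda>v. v (j + k)) + a (j + k))"
    using v_moment(1) by simp
  ultimately show ?thesis
    using Ex_sm_le[OF assms, of j k] v_moment(2)[of "j + k"] by linarith
qed

end

lemma Ex_abs_d_le_central:
  assumes "p = 1"
  shows "Ex (\<lambda>v. \<bar>d j v\<bar>) \<le> 1 / ((1 - lam) * real N)"
proof -
  have "lam * (a 0 - a 1) - g_fun lam p a 1 = 0"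
    using a_eqs assms by (auto simp: vI_eqs_def)
  then have "g_fun lam p a 1 = lam"
    using Vbar_zero[OF a_in] by simp
  \<comment> \<open>A positive \<open>a 1\<close> would make \<open>g_fun\<close> equal to
    \<open>p = 1\<close>, but it is \<open>lam < 1\<close>.\<close>
  then have a_1: "a 1 = 0"
    using lam assms Vbar_nonneg[OF a_in, of 1] by (auto simp: g_fun_def split: if_splits)
  have "\<bar>d j v\<bar> \<le> v 1" if v: "v \<in> st" for v
  proof (cases j)
    case 0
    then show ?thesis using d_zero[OF v] a_1 v_nonneg[OF v, of 1] by (simp add: d_def)
  next
    case (Suc i)
    then have "a j = 0"
      using Vbar_antimono[OF a_in, of 1 j] Vbar_nonneg[OF a_in, of j] a_1 by simp
    then show ?thesis
      using v_antimono[OF v, of 1 j] v_nonneg[OF v, of j] Suc by (simp add: d_def)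
  qed
  then have "Ex (\<lambda>v. \<bar>d j v\<bar>) \<le> Ex (\<lambda>v. v 1)"
    using integrable_d v_moment(1) by (intro Ex_mono) auto
  also have "\<dots> \<le> 1 / ((1 - lam) * real N)" by (rule Ex_v_1_le[OF assms])
  finally show ?thesis .
qed

end

section \<open>The equilibrium and the limit\<close>

lemma Vbar_eq_suminf:
  assumes "a \<in> Vbar"
  shows "a i = (\<Sum>j. s_of_v a (i + j))"
proof -
  obtain s where s: "\<forall>i. (\<lambda>j. s (i + j)) sums a i" "s_of_v a = s"
    by (rule VbarE[OF assms])
  show ?thesis unfolding s(2) by (rule sums_unique[OF s(1)[rule_format]])
qed

lemma Vbar_pos_iff:
  assumes a: "a \<in> Vbar"
  shows "0 < a i \<longleftrightarrow> 0 < s_of_v a i"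
proof
  show "0 < s_of_v a i" if "0 < a i"
  proof (rule ccontr)
    assume "\<not> 0 < s_of_v a i"
    then have s_i: "s_of_v a i = 0" using Vbar_s(2)[OF a, of i] by simp
    have "s_of_v a (i + j) = 0" for j
    proof (induction j)
      case (Suc j)
      then show ?case using Vbar_s(2,4)[OF a, of "i + j"] Vbar_s(2)[OF a, of "i + Suc j"] by simp
    qed (simp add: s_i)
    then show False using that Vbar_eq_suminf[OF a, of i] by simp
  qed
  show "0 < a i" if "0 < s_of_v a i"
    using that Vbar_nonneg[OF a, of "Suc i"] by (simp add: s_of_v_def)
qed

text \<open>Solves the equilibrium equation for the next level under full central service and clips
  at 0. For \<open>p = 1\<close> division by zero yields 0, which is the empty equilibrium.\<close>

primrec sI :: "real \<Rightarrow> real \<Rightarrow> nat \<Rightarrow> real" where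
  "sI lam p 0 = 1"
| "sI lam p (Suc i) = max 0 ((lam * sI lam p i - p) / (1 - p))"

lemma s_of_v_equilibrium:
  assumes lam: "0 \<le> lam" "lam < 1" and p: "0 \<le> p" "p \<le> 1"
    and a: "a \<in> Vbar" and eqs: "vI_eqs lam p a"
  shows "s_of_v a i = sI lam p i"
proof (induction i)
  case 0
  then show ?case using Vbar_s(1)[OF a] by simp
next
  case (Suc i)
  have "lam * (a i - a (Suc i)) - (1 - p) * (a (Suc i) - a (Suc (Suc i))) - g_fun lam p a (Suc i) = 0"
    using eqs by (auto simp: vI_eqs_def dest: spec[of _ "Suc i"])
  then have eq: "lam * s_of_v a i - (1 - p) * s_of_v a (Suc i) = g_fun lam p a (Suc i)"
    by (simp add: s_of_v_def)
  have lam_s: "lam * s_of_v a i \<le> lam"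
    using mult_left_mono[OF Vbar_s(3)[OF a, of i] lam(1)] by simp
  show ?case
  proof (cases "0 < a (Suc i)")
    case True
    then have eq': "lam * s_of_v a i - p = (1 - p) * s_of_v a (Suc i)"
      using eq by (simp add: g_fun_def)
    \<comment> \<open>\<open>p = 1\<close> would give \<open>lam * s_of_v a i = 1\<close>, above its
      bound \<open>lam\<close>.\<close>
    have "p \<noteq> 1" using eq' lam_s lam by auto
    then have "s_of_v a (Suc i) = (lam * s_of_v a i - p) / (1 - p)"
      using eq' by simp
    then show ?thesis
      using Suc.IH Vbar_s(2)[OF a, of "Suc i"] by simp
  next
    case False
    then have s_0: "s_of_v a (Suc i) = 0"
      using Vbar_pos_iff[OF a, of "Suc i"] Vbar_s(2)[OF a, of "Suc i"] by simp
    have "g_fun lam p a (Suc i) \<le> p" using p by (simp add: g_fun_def)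
    then have "(lam * s_of_v a i - p) / (1 - p) \<le> 0"
      using eq s_0 p by (intro divide_nonpos_nonneg) auto
    then show ?thesis using Suc.IH s_0 by simp
  qed
qed

lemma equilibrium_unique:
  assumes "0 \<le> lam" "lam < 1" "0 \<le> p" "p \<le> 1"
    and "a \<in> Vbar" "vI_eqs lam p a" "b \<in> Vbar" "vI_eqs lam p b"
  shows "a = b"
proof
  fix i
  show "a i = b i"
    unfolding Vbar_eq_suminf[OF assms(5)] Vbar_eq_suminf[OF assms(7)]
      s_of_v_equilibrium[OF assms(1-6)] s_of_v_equilibrium[OF assms(1-4,7,8)] ..
qed

lemma equilibrium_exists:
  assumes lam: "0 \<le> lam" "lam < 1" and p: "0 \<le> p" "p \<le> 1"
  shows "\<exists>a. a \<in> Vbar \<and> vI_eqs lam p a"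
proof -
  let ?s = "sI lam p"
  have nonneg: "0 \<le> ?s i" for i by (cases i) auto
  \<comment> \<open>Any x \<le> 1 satisfies x - p \<le> (1 - p) x. The resulting ratio
    \<open>lam\<close> gives both summability and monotonicity.\<close>
  have decay: "?s (Suc i) \<le> lam * ?s i" if "?s i \<le> 1" for i
  proof -
    have le: "lam * ?s i \<le> 1 * 1" using lam nonneg that by (intro mult_mono) auto
    have "(lam * ?s i - p) / (1 - p) \<le> lam * ?s i"
    proof (cases "p = 1")
      case False
      have "p * (lam * ?s i) \<le> p * 1" using le p by (intro mult_left_mono) auto
      then show ?thesis using False p by (simp add: pos_divide_le_eq algebra_simps)
    qed (use lam nonneg in simp)
    then show ?thesis using lam nonneg by simp
  qed
  have bound: "?s i \<le> lam ^ i" and le_1: "?s i \<le> 1" for i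
  proof -
    have "?s i \<le> lam ^ i \<and> ?s i \<le> 1"
    proof (induction i)
      case (Suc i)
      have "?s (Suc i) \<le> lam * ?s i" using Suc by (intro decay) simp
      moreover have "lam * ?s i \<le> lam * lam ^ i" using Suc lam by (intro mult_left_mono) auto
      moreover have "lam * ?s i \<le> 1 * 1" using lam nonneg Suc by (intro mult_mono) auto
      ultimately show ?case unfolding power_Suc by linarith
    qed simp
    then show "?s i \<le> lam ^ i" "?s i \<le> 1" by auto
  qed
  have antimono: "?s (Suc i) \<le> ?s i" for i
    using decay[OF le_1[of i]] mult_right_mono[OF less_imp_le[OF lam(2)] nonneg[of i]] by linarith
  have "summable ?s"
    using lam bound nonneg by (intro summable_comparison_test'[OF summable_geometric[of lam]]) auto
  then have Sbar: "?s \<in> Sbar"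
    using nonneg le_1 antimono by (simp add: Sbar_def summable_Suc_iff)
  define a where "a i = (\<Sum>j. ?s (i + j))" for i
  have a: "a \<in> Vbar" using Sbar by (auto simp: Vbar_def a_def)
  have "s_of_v a = ?s"
  proof
    fix i
    have "summable (\<lambda>j. ?s (i + j))"
      using summable_ignore_initial_segment[OF \<open>summable ?s\<close>, of i] by (simp add: add.commute)
    from suminf_split_head[OF this] show "s_of_v a i = ?s i"
      by (simp add: s_of_v_def a_def)
  qed
  then have a_s: "a i - a (Suc i) = ?s i" for i
    by (simp add: s_of_v_def fun_eq_iff)
  have a_pos: "0 < a i \<longleftrightarrow> 0 < ?s i" for i
    using Vbar_pos_iff[OF a, of i] a_s[of i] by (simp add: s_of_v_def)
  have "vI_eqs lam p a"
    unfolding vI_eqs_def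
  proof (intro allI impI)
    fix i :: nat assume "1 \<le> i"
    then obtain k where i: "i = Suc k" by (cases i) auto
    have "lam * ?s k - (1 - p) * ?s (Suc k) = g_fun lam p a (Suc k)"
    proof (cases "0 < ?s (Suc k)")
      case True
      then have pos: "0 < (lam * ?s k - p) / (1 - p)" by simp
      then have "p \<noteq> 1" by auto
      then have "(1 - p) * ?s (Suc k) = lam * ?s k - p" using pos by simp
      moreover have "0 < a (Suc k)" using True a_pos by blast
      ultimately show ?thesis by (simp add: g_fun_def del: sI.simps)
    next
      case False
      then have s_0: "?s (Suc k) = 0" using nonneg[of "Suc k"] by linarith
      have "a (Suc k) = 0" using False a_pos[of "Suc k"] Vbar_nonneg[OF a, of "Suc k"] by auto
      \<comment> \<open>With nothing above level k, \<open>a k\<close> equals the level itself.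
        Clipping means that lam times it is at most \<open>p\<close>, so the minimum in
        \<open>g_fun\<close> is exactly the inflow.\<close>
      then have a_k: "a k = ?s k" using a_s[of k] by simp
      have "lam * ?s k \<le> p"
      proof (cases "p = 1")
        case True
        have "lam * ?s k \<le> 1 * 1" using lam nonneg le_1 by (intro mult_mono) auto
        then show ?thesis using True by simp
      next
        case ne: False
        then have "0 < 1 - p" using p by simp
        then show ?thesis using False by (simp add: not_less divide_le_0_iff)
      qed
      moreover have "\<not> 0 < a (Suc k)" using False a_pos by blast
      moreover have "?s k = 0" if "\<not> 0 < a k" using that nonneg[of k] a_k by simp
      ultimately show ?thesis
        unfolding s_0 using a_k by (auto simp: g_fun_def min_def simp del: sI.simps)
    qed
    then show "lam * (a (i - 1) - a i) - (1 - p) * (a i - a (i + 1)) - g_fun lam p a i = 0"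
      using a_s[of k] a_s[of "Suc k"] by (simp add: i)
  qed
  with a show ?thesis by blast
qed

text \<open>The head is bounded by its l1 norm. The weights from \<open>2 * l\<close> on sum to
  twice a power of 1/4; cutting at an even index keeps the root a power of 1/2, and sqrt 2 is
  rounded up to 2.\<close>

lemma wnorm_le:
  assumes bound: "\<And>i. \<bar>x i\<bar> \<le> c"
  shows "wnorm x \<le> (\<Sum>i<2 * l. \<bar>x i\<bar>) + 2 * (1 / 2) ^ l * c"
proof -
  let ?A = "\<Sum>i<2 * l. \<bar>x i\<bar>" and ?B = "2 * (1 / 2) ^ l * c"
  have c: "0 \<le> c" using bound[of 0] by linarith
  have x2: "(x i)\<^sup>2 \<le> c\<^sup>2" for i
    using power_mono[OF bound abs_ge_zero, of i 2] by simp
  have term_le: "(1 / 2) ^ i * (x i)\<^sup>2 \<le> (1 / 2) ^ i * c\<^sup>2" for i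
    using x2 by (intro mult_left_mono) auto
  have geo: "(\<lambda>i. (1 / 2) ^ i * c\<^sup>2) sums (2 * c\<^sup>2)"
    using sums_mult2[OF geometric_sums[of "1 / 2 :: real"], of "c\<^sup>2"] by simp
  have summable: "summable (\<lambda>i. (1 / 2) ^ i * (x i)\<^sup>2)"
    using term_le by (intro summable_comparison_test'[OF sums_summable[OF geo]]) auto
  have "(\<Sum>i. (1 / 2) ^ i * (x i)\<^sup>2)
      = (\<Sum>i. (1 / 2) ^ (i + 2 * l) * (x (i + 2 * l))\<^sup>2) + (\<Sum>i<2 * l. (1 / 2) ^ i * (x i)\<^sup>2)"
    by (rule suminf_split_initial_segment[OF summable])
  also have "(\<Sum>i. (1 / 2) ^ (i + 2 * l) * (x (i + 2 * l))\<^sup>2) \<le> (1 / 2) ^ (2 * l) * (2 * c\<^sup>2)"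
  proof (rule sums_le)
    show "(1 / 2) ^ (i + 2 * l) * (x (i + 2 * l))\<^sup>2 \<le> (1 / 2) ^ (2 * l) * ((1 / 2) ^ i * c\<^sup>2)" for i
      using term_le[of "i + 2 * l"]
      by (intro order_trans[OF mult_left_mono[OF x2]]) (auto simp: power_add)
    show "(\<lambda>i. (1 / 2) ^ (i + 2 * l) * (x (i + 2 * l))\<^sup>2) sums (\<Sum>i. (1 / 2) ^ (i + 2 * l) * (x (i + 2 * l))\<^sup>2)"
      using summable_ignore_initial_segment[OF summable, of "2 * l"] by (rule summable_sums)
    show "(\<lambda>i. (1 / 2) ^ (2 * l) * ((1 / 2) ^ i * c\<^sup>2)) sums ((1 / 2) ^ (2 * l) * (2 * c\<^sup>2))"
      using geo by (rule sums_mult)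
  qed
  also have "(1 / 2) ^ (2 * l) * (2 * c\<^sup>2) \<le> ?B\<^sup>2"
    by (simp add: power_mult_distrib power_mult[symmetric] mult.commute)
  also have "(\<Sum>i<2 * l. (1 / 2) ^ i * (x i)\<^sup>2) \<le> (\<Sum>i<2 * l. (x i)\<^sup>2)"
    by (intro sum_mono mult_left_le_one_le) (auto simp: power_le_one)
  also have "(\<Sum>i<2 * l. (x i)\<^sup>2) \<le> ?A\<^sup>2"
  proof -
    have "sqrt (\<Sum>i<2 * l. (x i)\<^sup>2) \<le> ?A"
      using L2_set_le_sum_abs[of x "{..<2 * l}"] by (simp add: L2_set_def)
    then show ?thesis by (rule sqrt_le_D)
  qed
  also have "?B\<^sup>2 + ?A\<^sup>2 \<le> (?A + ?B)\<^sup>2"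
    using c by (simp add: power2_sum sum_nonneg)
  finally show ?thesis
    unfolding wnorm_def using c by (intro real_le_lsqrt) (simp_all add: sum_nonneg)
qed

section \<open>From single coordinates to bounded continuous test functions\<close>

lemma stationary_coordinate_tendsto:
  assumes lam: "0 \<le> lam" "lam < 1" and p: "0 \<le> p" "p \<le> 1"
    and a: "a \<in> Vbar" "vI_eqs lam p a"
    and stat: "\<And>N. 1 \<le> N \<Longrightarrow> ctmc_stationary (qV lam p N) (XV N) (\<pi> N)"
  shows "(\<lambda>N. measure_pmf.expectation (\<pi> N) (\<lambda>v. \<bar>v j - a j\<bar>)) \<longlonglongrightarrow> 0"
proof -
  have target: "target_system lam p N (\<pi> N) a" if "1 \<le> N" for N
    using lam p a stat[OF that] that by unfold_locales auto
  let ?E = "\<lambda>N. measure_pmf.expectation (\<pi> N) (\<lambda>v. \<bar>v j - a j\<bar>)"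
  have inv_N: "(\<lambda>N. C / real N) \<longlonglongrightarrow> 0" for C :: real
    by (rule lim_const_over_n)
  \<comment> \<open>This shape separates what is fixed beforehand, \<open>B\<close> through k and
    \<delta>, from what vanishes as N grows.\<close>
  have small: "\<exists>B C. B < e \<and> (\<forall>N\<ge>1. ?E N \<le> B + C / real N)" if e: "0 < e" for e
  proof (cases "p = 1")
    case True
    have "?E N \<le> 0 + (1 / (1 - lam)) / real N" if "1 \<le> N" for N
      using target_system.Ex_abs_d_le_central[OF target[OF that] True, of j]
      by (simp add: target_system.d_def[OF target[OF that]])
    with e show ?thesis by blast
  next
    case False
    have "(\<lambda>k. lam ^ (j + k) / (1 - lam) + a (j + k)) \<longlonglongrightarrow> 0 / (1 - lam) + 0"
      unfolding add.commute[of j] using lam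
      by (intro tendsto_add tendsto_divide tendsto_const LIMSEQ_ignore_initial_segment
          LIMSEQ_realpow_zero Vbar_tendsto_0[OF a(1)]) auto
    then have "\<forall>\<^sub>F k in sequentially. lam ^ (j + k) / (1 - lam) + a (j + k) < e / 2"
      using e by (intro order_tendstoD(2)) auto
    then obtain k where k: "lam ^ (j + k) / (1 - lam) + a (j + k) < e / 2"
      by (auto simp: eventually_sequentially)
    define \<delta> where "\<delta> = e / 2"
    define C where "C = (\<Sum>i<k. drift_const lam p (j + i)) / \<delta>"
    have "?E N \<le> lam ^ (j + k) / (1 - lam) + a (j + k) + \<delta> + C / real N" if "1 \<le> N" for N
      using target_system.Ex_abs_d_le[OF target[OF that], of \<delta> j k] e False p
      by (simp add: target_system.d_def[OF target[OF that]] \<delta>_def C_def)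
    moreover have "lam ^ (j + k) / (1 - lam) + a (j + k) + \<delta> < e"
      using k unfolding \<delta>_def by linarith
    ultimately show ?thesis by blast
  qed
  show ?thesis
  proof (rule tendstoI)
    fix e :: real assume "0 < e"
    from small[OF this] obtain B C where B: "B < e" and le: "\<forall>N\<ge>1. ?E N \<le> B + C / real N" by blast
    have "(\<lambda>N. B + C / real N) \<longlonglongrightarrow> B + 0"
      by (intro tendsto_add tendsto_const inv_N)
    then have "\<forall>\<^sub>F N in sequentially. B + C / real N < e"
      using B by (intro order_tendstoD(2)) auto
    then show "\<forall>\<^sub>F N in sequentially. dist (?E N) 0 < e"
      using eventually_ge_at_top[of 1]
    proof eventually_elim
      case (elim N)
      have "0 \<le> ?E N" by (intro Bochner_Integration.integral_nonneg) simp
      moreover have "?E N \<le> B + C / real N" using le elim by blast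
      ultimately show ?case using elim by (simp add: dist_real_def)
    qed
  qed
qed

text \<open>Near the equilibrium \<open>f\<close> varies little by continuity, and elsewhere its variation is at most the
  multiple \<open>2 B / d\<close> of the distance, whose mean is controlled by the first moments.\<close>
lemma stationary_expectation_tendsto:
  fixes f :: "(nat \<Rightarrow> real) \<Rightarrow> real"
  assumes lam: "0 \<le> lam" "lam < 1" and p: "0 \<le> p" "p \<le> 1"
    and a: "a \<in> Vbar" "vI_eqs lam p a"
    and stat: "\<And>N. 1 \<le> N \<Longrightarrow> ctmc_stationary (qV lam p N) (XV N) (\<pi> N)"
    and B: "\<forall>v\<in>Vbar. \<bar>f v\<bar> \<le> B"
    and cont: "\<forall>e>0. \<exists>d>0. \<forall>y\<in>Vbar. wnorm (\<lambda>i. y i - a i) < d \<longrightarrow> \<bar>f y - f a\<bar> < e"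
  shows "(\<lambda>N. measure_pmf.expectation (\<pi> N) f) \<longlonglongrightarrow> f a"
proof (rule tendstoI)
  fix e :: real assume e: "0 < e"
  then obtain d where d: "0 < d" and near: "\<forall>y\<in>Vbar. wnorm (\<lambda>i. y i - a i) < d \<longrightarrow> \<bar>f y - f a\<bar> < e / 2"
    using cont half_gt_zero[OF e] by blast
  have B_nonneg: "0 \<le> B" using bspec[OF B a(1)] by linarith
  define K where "K = 2 * B / d"
  have K: "0 \<le> K" using B_nonneg d by (simp add: K_def)
  have lipschitz: "\<bar>f y - f a\<bar> \<le> e / 2 + K * D" if y: "y \<in> Vbar" and D: "0 \<le> D" "wnorm (\<lambda>i. y i - a i) \<le> D" for y D
  proof (cases "wnorm (\<lambda>i. y i - a i) < d")
    case True
    have "0 \<le> K * D" using D K by simp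
    moreover have "\<bar>f y - f a\<bar> < e / 2" using near y True by blast
    ultimately show ?thesis by linarith
  next
    case False
    then have "K * d \<le> K * D" using D K by (intro mult_left_mono) auto
    then have "2 * B \<le> K * D" using d by (simp add: K_def)
    moreover have "\<bar>f y\<bar> \<le> B" "\<bar>f a\<bar> \<le> B" using B y a(1) by auto
    ultimately show ?thesis using e by linarith
  qed
  \<comment> \<open>Bounds the mean of \<open>v 0 + a 0\<close>, which dominates every \<bar>v i - a
    i\<bar> because both sequences decrease. It is uniform in N, so the cut \<open>l\<close> can be
    fixed first.\<close>
  define W where "W = 1 / (1 - lam) + a 0"
  have lim: "(\<lambda>l. e / 2 + K * (2 * (1 / 2) ^ l * W)) \<longlonglongrightarrow> e / 2 + K * (2 * 0 * W)"
    by (intro tendsto_add tendsto_mult tendsto_const LIMSEQ_realpow_zero) auto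
  have "\<forall>\<^sub>F l in sequentially. e / 2 + K * (2 * (1 / 2) ^ l * W) < e"
    by (rule order_tendstoD(2)[OF lim]) (use e in simp)
  then obtain l where l: "e / 2 + K * (2 * (1 / 2) ^ l * W) < e"
    by (auto simp: eventually_sequentially)
  let ?E = "\<lambda>N i. measure_pmf.expectation (\<pi> N) (\<lambda>v. \<bar>v i - a i\<bar>)"
  have le: "\<bar>measure_pmf.expectation (\<pi> N) f - f a\<bar>
      \<le> e / 2 + K * ((\<Sum>i<2 * l. ?E N i) + 2 * (1 / 2) ^ l * W)" if N: "1 \<le> N" for N
  proof -
    interpret target_system lam p N "\<pi> N" a
      using lam p a stat[OF N] N by unfold_locales auto
    define G where "G v = (\<Sum>i<2 * l. \<bar>v i - a i\<bar>) + 2 * (1 / 2) ^ l * (v 0 + a 0)" for v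
    have in_Vbar: "v \<in> Vbar" if "v \<in> st" for v
      using XV_subset_Vbar[OF N] that by blast
    have int_f: "integrable (measure_pmf (\<pi> N)) f"
      using in_Vbar B by (intro integrable_bounded[where B=B]) auto
    have int_abs: "integrable (measure_pmf (\<pi> N)) (\<lambda>v. \<bar>v i - a i\<bar>)" for i
      using v_moment(1) by simp
    have int_G: "integrable (measure_pmf (\<pi> N)) G"
      unfolding G_def using v_moment(1) int_abs by (intro Bochner_Integration.integrable_add Bochner_Integration.integrable_sum integrable_mult_right) auto
    have f_le: "\<bar>f v - f a\<bar> \<le> e / 2 + K * G v" if v: "v \<in> st" for v
    proof (rule lipschitz[OF in_Vbar[OF v]])
      have "\<bar>v i - a i\<bar> \<le> v 0 + a 0" for i
        using v_nonneg[OF v, of i] v_antimono[OF v, of 0 i] Vbar_nonneg[OF a(1), of i] Vbar_antimono[OF a(1), of 0 i]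
        by linarith
      then show "wnorm (\<lambda>i. v i - a i) \<le> G v" unfolding G_def by (rule wnorm_le)
      show "0 \<le> G v"
        unfolding G_def using v_nonneg[OF v, of 0] Vbar_nonneg[OF a(1), of 0] by (simp add: sum_nonneg)
    qed
    have "measure_pmf.expectation (\<pi> N) f - f a = Ex (\<lambda>v. f v - f a)"
      using int_f by simp
    also have "\<bar>\<dots>\<bar> \<le> Ex (\<lambda>v. \<bar>f v - f a\<bar>)"
      by (rule integral_abs_bound)
    also have "\<dots> \<le> Ex (\<lambda>v. e / 2 + K * G v)"
      using int_f int_G f_le by (intro Ex_mono) auto
    also have "\<dots> = e / 2 + K * Ex G"
      using int_G by simp
    also have "Ex G = (\<Sum>i<2 * l. ?E N i) + 2 * (1 / 2) ^ l * (Ex (\<lambda>v. v 0) + a 0)"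
      unfolding G_def using int_abs v_moment(1) by simp
    also have "K * \<dots> \<le> K * ((\<Sum>i<2 * l. ?E N i) + 2 * (1 / 2) ^ l * W)"
      using v_moment(2)[of 0] K by (intro mult_left_mono add_left_mono) (auto simp: W_def)
    finally show ?thesis by simp
  qed
  have lim': "(\<lambda>N. e / 2 + K * ((\<Sum>i<2 * l. ?E N i) + 2 * (1 / 2) ^ l * W))
      \<longlonglongrightarrow> e / 2 + K * ((\<Sum>i<2 * l. 0) + 2 * (1 / 2) ^ l * W)"
    by (intro tendsto_add tendsto_mult tendsto_sum tendsto_const stationary_coordinate_tendsto[OF lam p a stat])
  have "\<forall>\<^sub>F N in sequentially. e / 2 + K * ((\<Sum>i<2 * l. ?E N i) + 2 * (1 / 2) ^ l * W) < e"
    by (rule order_tendstoD(2)[OF lim']) (use l in simp)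
  then show "\<forall>\<^sub>F N in sequentially. dist (measure_pmf.expectation (\<pi> N) f) (f a) < e"
    using eventually_ge_at_top[of 1] by eventually_elim (unfold dist_real_def, rule le_less_trans[OF le])
qed

text \<open>Convergence in distribution is tested on bounded functions continuous for
  \<open>wnorm\<close>; against a point mass the integral is just \<open>f vI\<close>. The law at N
  = 0 is arbitrary and does not affect the limit.\<close>

theorem theorem5:
  fixes lam p :: real
  assumes "0 \<le> lam" "lam < 1" "0 \<le> p" "p \<le> 1"
  shows "(\<forall>N\<ge>1. ctmc_pos_recurrent (LamN lam N) (qV lam p N) (XV N)
                 \<and> (\<exists>!\<pi>. ctmc_stationary (qV lam p N) (XV N) \<pi>))
       \<and> (\<exists>!vI. vI \<in> Vbar \<and> vI_eqs lam p vI)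
       \<and> (\<forall>vI \<pi>. vI \<in> Vbar \<and> vI_eqs lam p vI
              \<and> (\<forall>N\<ge>1. ctmc_stationary (qV lam p N) (XV N) (\<pi> N)) \<longrightarrow>
            (\<forall>f :: (nat \<Rightarrow> real) \<Rightarrow> real.
               (\<exists>B. \<forall>v\<in>Vbar. \<bar>f v\<bar> \<le> B) \<and>
               (\<forall>x\<in>Vbar. \<forall>e>0. \<exists>d>0. \<forall>y\<in>Vbar. wnorm (\<lambda>i. y i - x i) < d \<longrightarrow> \<bar>f y - f x\<bar> < e)
               \<longrightarrow> (\<lambda>N. measure_pmf.expectation (\<pi> N) f) \<longlonglongrightarrow> f vI))"
proof (intro conjI allI impI)
  fix N :: nat assume "1 \<le> N"
  then interpret system lam p N using assms by unfold_locales
  show "ctmc_pos_recurrent (LamN lam N) (qV lam p N) (XV N)"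
    and "\<exists>!\<pi>. ctmc_stationary (qV lam p N) (XV N) \<pi>"
    by (rule positive_recurrent)+
next
  show "\<exists>!vI. vI \<in> Vbar \<and> vI_eqs lam p vI"
    using equilibrium_exists[OF assms] equilibrium_unique[OF assms] by (intro ex_ex1I) auto
qed (use stationary_expectation_tendsto[OF assms] in blast)

end
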